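(* Let $E\subset\mathbb{R}$. Then $E$ is median porous if and only if $E$ is both left median porous and right median porous.
   Context: Lebesgue measure on $\mathbb{R}$ is denoted $|\cdot|$. Throughout, $I=(a,b)$ with $a<b$ real denotes a bounded open interval; $I^-=(a,\frac{a+b}{2})$ and $I^+=(\frac{a+b}{2},b)$. For $E\subset\mathbb{R}$, $0<s\le1$ and an open interval $I$, $L_s(E,I)$ is the supremum of all $\ell>0$ for which there exist an integer $k\ge1$ and disjoint open intervals $I_1,\dots,I_k\subset I\setminus E$ with $|I_i|\ge\ell$ for all $i$ and $\sum_{i=1}^k|I_i|\ge(1-s)|I|$; if no such $\ell$ exists, $L_s(E,I)=0$. Let $0<s<t<1$ and $0<\delta<1$. - $E$ is $(s,t,\delta)$-median porous if for every $I$ there exist finitely many disjoint open intervals $I_1,\dots,I_k\subset I\setminus E$ with $|I_i|\ge\delta L_t(E,I)$ for all $i$ and $\sum_i|I_i|\ge(1-s)|I|$. - $E$ is $(s,t,\delta)$-right median porous if for every $I$ there exist finitely many disjoint open intervals $I_1,\dots,I_k\subset I^-\setminus E$ with $|I_i|\ge\delta L_t(E,I^+)$ for all $i$ and $\sum_i|I_i|\ge(1-s)|I^-|$. - $E$ is $(s,t,\delta)$-left median porous if the same holds with $I^-$ and $I^+$ interchanged: for every $I$ there exist finitely many disjoint open intervals $I_1,\dots,I_k\subset I^+\setminus E$ with $|I_i|\ge\delta L_t(E,I^-)$ for all $i$ and $\sum_i|I_i|\ge(1-s)|I^+|$. $E$ is median porous (resp. right median porous, left median porous) if it is $(s,t,\delta)$-median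 porous (resp. $(s,t,\delta)$-right, $(s,t,\delta)$-left median porous) for some $0<s<t<1$ and some $0<\delta<1$; the parameters may differ from one notion to another. *)

theory Defs
  imports "HOL-Analysis.Analysis"
begin

definition bounded_open_interval :: "real set \<Rightarrow> bool" where
  "bounded_open_interval J \<longleftrightarrow> (\<exists>a b. a < b \<and> J = {a<..<b})"

text \<open>
  The finite family of disjoint intervals is a set of nonempty intervals, so it has no repetitions
  and \<open>k\<close> is its cardinality.
\<close>
definition disjoint_intervals_in :: "real set set \<Rightarrow> real set \<Rightarrow> bool" where
  "disjoint_intervals_in F A \<longleftrightarrow>
     finite F \<and> disjoint F \<and> (\<forall>J\<in>F. bounded_open_interval J \<and> J \<subseteq> A)"

definition admissible_lengths :: "real \<Rightarrow> real set \<Rightarrow> real set \<Rightarrow> real set" where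
  "admissible_lengths s E I = {l. l > 0 \<and> (\<exists>F. F \<noteq> {} \<and> disjoint_intervals_in F (I - E) \<and>
     (\<forall>J\<in>F. measure lebesgue J \<ge> l) \<and>
     (\<Sum>J\<in>F. measure lebesgue J) \<ge> (1 - s) * measure lebesgue I)}"

text \<open>
  For a bounded interval \<open>I\<close> the admissible lengths are bounded above by the length of \<open>I\<close>, so the
  real supremum is the intended one; only the empty case needs a separate convention.
\<close>
definition L :: "real \<Rightarrow> real set \<Rightarrow> real set \<Rightarrow> real" where
  "L s E I = (if admissible_lengths s E I = {} then 0 else Sup (admissible_lengths s E I))"

definition median_porous_with :: "real \<Rightarrow> real \<Rightarrow> real \<Rightarrow> real set \<Rightarrow> bool" where
  "median_porous_with s t \<delta> E \<longleftrightarrow>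
     (\<forall>a b. a < b \<longrightarrow>
       (let I = {a<..<b} in
        \<exists>F. disjoint_intervals_in F (I - E) \<and>
          (\<forall>J\<in>F. measure lebesgue J \<ge> \<delta> * L t E I) \<and>
          (\<Sum>J\<in>F. measure lebesgue J) \<ge> (1 - s) * measure lebesgue I))"

definition right_median_porous_with :: "real \<Rightarrow> real \<Rightarrow> real \<Rightarrow> real set \<Rightarrow> bool" where
  "right_median_porous_with s t \<delta> E \<longleftrightarrow>
     (\<forall>a b. a < b \<longrightarrow>
       (let I_minus = {a<..<(a + b) / 2}; I_plus = {(a + b) / 2<..<b} in
        \<exists>F. disjoint_intervals_in F (I_minus - E) \<and>
          (\<forall>J\<in>F. measure lebesgue J \<ge> \<delta> * L t E I_plus) \<and>
          (\<Sum>J\<in>F. measure lebesgue J) \<ge> (1 - s) * measure lebesgue I_minus))"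

definition left_median_porous_with :: "real \<Rightarrow> real \<Rightarrow> real \<Rightarrow> real set \<Rightarrow> bool" where
  "left_median_porous_with s t \<delta> E \<longleftrightarrow>
     (\<forall>a b. a < b \<longrightarrow>
       (let I_minus = {a<..<(a + b) / 2}; I_plus = {(a + b) / 2<..<b} in
        \<exists>F. disjoint_intervals_in F (I_plus - E) \<and>
          (\<forall>J\<in>F. measure lebesgue J \<ge> \<delta> * L t E I_minus) \<and>
          (\<Sum>J\<in>F. measure lebesgue J) \<ge> (1 - s) * measure lebesgue I_plus))"

definition median_porous :: "real set \<Rightarrow> bool" where
  "median_porous E \<longleftrightarrow>
     (\<exists>s t \<delta>. 0 < s \<and> s < t \<and> t < 1 \<and> 0 < \<delta> \<and> \<delta> < 1 \<and> median_porous_with s t \<delta> E)"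

definition right_median_porous :: "real set \<Rightarrow> bool" where
  "right_median_porous E \<longleftrightarrow>
     (\<exists>s t \<delta>. 0 < s \<and> s < t \<and> t < 1 \<and> 0 < \<delta> \<and> \<delta> < 1 \<and> right_median_porous_with s t \<delta> E)"

definition left_median_porous :: "real set \<Rightarrow> bool" where
  "left_median_porous E \<longleftrightarrow>
     (\<exists>s t \<delta>. 0 < s \<and> s < t \<and> t < 1 \<and> 0 < \<delta> \<and> \<delta> < 1 \<and> left_median_porous_with s t \<delta> E)"

end

theory Submission
  imports Defs
begin

text \<open>
  For a length \<open>l\<close> let \<open>gap_union E l\<close> be the union of all open intervals of length at least \<open>l\<close> that
  miss \<open>E\<close>. Up to constant factors in \<open>l\<close> and arbitrarily small changes of the parameters, each of the
  three notions says that if this set has density at least \<open>p\<close> in an interval, then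
  \<open>gap_union E (c * l)\<close> has density at least \<open>q > p\<close> in the same interval (median), in its left
  neighbour of equal length (right median) or in its right neighbour (left median). This is the
  predicate \<open>spreads\<close>, with the constant \<open>c\<close> quantified inside. If \<open>L\<close> vanishes, only a
  family of large total length is required; each notion provides such families in every interval,
  since every interval is the target of a comparison.

  Median porosity implies both one-sided versions by small shifts: after the density has been raised
  to \<open>q\<close>, the interval may be translated by \<open>q - p\<close> times its length before the density falls below
  \<open>p\<close>, and the argument can be repeated (\<open>spreads_all_shifts\<close>).

  Conversely, one would like to go to the right neighbour and back. The parameters of the two
  conditions are unrelated, though: the density \<open>q'\<close> found on the right may be smaller than the
  threshold \<open>p\<close> for the way back. The main step (\<open>spreads_left_imp_condenses\<close>) is that the condition
  which leads to the left, alone, turns any positive density on an interval into density \<open>p\<close> on a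
  subinterval of comparable length. If no such subinterval exists, the gaps are enclosed in disjoint
  intervals of density exactly \<open>p\<close> to which the condition applies, and it multiplies the total gap
  measure by nearly \<open>q / p > 1\<close> (\<open>rising_sun_growth\<close>); after boundedly many repetitions the density of
  the whole interval exceeds \<open>p\<close>, and the interval is itself such a subinterval. From the subinterval
  one returns by tiling the original interval with translates (\<open>spreads_left_right_combine\<close>).
\<close>

section \<open>The union of long gaps\<close>

definition gap_union :: "real set \<Rightarrow> real \<Rightarrow> real set" where
  "gap_union E l = \<Union>{{u<..<v} | u v. l \<le> v - u \<and> {u<..<v} \<inter> E = {}}"

text \<open>
  Sets of whole gaps avoid the families of intervals in the definition of median porosity: a family
  has to be cut anew whenever the ambient interval changes, whereas \<open>gap_measure E l x y\<close> is additive
  in the interval \<open>(x, y)\<close> and antitone in the length \<open>l\<close>.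
\<close>
definition gap_measure :: "real set \<Rightarrow> real \<Rightarrow> real \<Rightarrow> real \<Rightarrow> real" where
  "gap_measure E l x y = measure lebesgue (gap_union E l \<inter> {x<..<y})"

lemma mem_gap_unionE:
  assumes "z \<in> gap_union E l"
  obtains u v where "u < z" "z < v" "l \<le> v - u" "{u<..<v} \<inter> E = {}" "{u<..<v} \<subseteq> gap_union E l"
proof -
  obtain u v where "z \<in> {u<..<v}" "l \<le> v - u" "{u<..<v} \<inter> E = {}"
    using assms unfolding gap_union_def by blast
  moreover from this have "{u<..<v} \<subseteq> gap_union E l"
    unfolding gap_union_def by blast
  ultimately show thesis using that by auto
qed

lemma open_gap_union: "open (gap_union E l)"
  unfolding gap_union_def by (rule open_Union) auto

lemma gap_union_disjoint: "gap_union E l \<inter> E = {}"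
  unfolding gap_union_def by blast

lemma gap_union_antimono: "l' \<le> l \<Longrightarrow> gap_union E l \<subseteq> gap_union E l'"
  unfolding gap_union_def by (rule Union_mono) (auto, force)

lemma fmeasurable_gap_union_Int: "gap_union E l \<inter> {x<..<y} \<in> lmeasurable"
  by (intro lmeasurable_open bounded_Int open_Int open_gap_union) auto

lemma gap_measure_nonneg: "0 \<le> gap_measure E l x y"
  by (simp add: gap_measure_def)

lemma measure_interval: "x \<le> y \<Longrightarrow> measure lebesgue {x<..<y::real} = y - x"
  by simp

lemma gap_measure_le: "x \<le> y \<Longrightarrow> gap_measure E l x y \<le> y - x"
  unfolding gap_measure_def
  using measure_mono_fmeasurable[of "gap_union E l \<inter> {x<..<y}" "{x<..<y}" lebesgue]
    fmeasurable_gap_union_Int[of E l x y] by (auto simp: fmeasurableD)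

lemma gap_measure_antimono: "l' \<le> l \<Longrightarrow> gap_measure E l x y \<le> gap_measure E l' x y"
  unfolding gap_measure_def
  using gap_union_antimono[of l' l E] fmeasurable_gap_union_Int[of E l x y]
    fmeasurable_gap_union_Int[of E l' x y]
  by (intro measure_mono_fmeasurable) (auto simp: fmeasurableD)

lemma gap_measure_subinterval:
  "x \<le> x' \<Longrightarrow> y' \<le> y \<Longrightarrow> gap_measure E l x' y' \<le> gap_measure E l x y"
  unfolding gap_measure_def
  using fmeasurable_gap_union_Int[of E l x y] fmeasurable_gap_union_Int[of E l x' y']
  by (intro measure_mono_fmeasurable) (auto simp: fmeasurableD)

lemma gap_measure_add:
  assumes "x \<le> z" "z \<le> y"
  shows "gap_measure E l x y = gap_measure E l x z + gap_measure E l z y"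
proof -
  have "measure lebesgue (gap_union E l \<inter> {x<..<z} \<union> gap_union E l \<inter> {z<..<y})
      = gap_measure E l x z + gap_measure E l z y"
    unfolding gap_measure_def
    by (intro measure_Un_AE) (use fmeasurable_gap_union_Int in auto)
  moreover have "measure lebesgue (gap_union E l \<inter> {x<..<y})
      = measure lebesgue (gap_union E l \<inter> {x<..<z} \<union> gap_union E l \<inter> {z<..<y})"
  proof (rule measure_eq_AE)
    show "AE w in lebesgue. (w \<in> gap_union E l \<inter> {x<..<y}) =
        (w \<in> gap_union E l \<inter> {x<..<z} \<union> gap_union E l \<inter> {z<..<y})"
    proof (rule AE_I')
      show "{z} \<in> null_sets lebesgue"
        by (simp flip: negligible_iff_null_sets)
    qed (use assms in auto)
  qed (use fmeasurable_gap_union_Int[of E l x y] fmeasurable_gap_union_Int[of E l x z]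
     fmeasurable_gap_union_Int[of E l z y] in \<open>auto intro!: sets.Un dest: fmeasurableD\<close>)
  ultimately show ?thesis
    unfolding gap_measure_def by simp
qed

lemma gap_measure_full:
  assumes "{x<..<y} \<subseteq> gap_union E l" "x \<le> y"
  shows "gap_measure E l x y = y - x"
  using assms unfolding gap_measure_def by (simp add: Int_absorb1)

lemma gap_measure_empty:
  assumes "{x<..<y} \<inter> gap_union E l = {}"
  shows "gap_measure E l x y = 0"
  using assms unfolding gap_measure_def by (simp add: Int_commute)

lemma gap_union_uminus: "gap_union (uminus ` E) l = uminus ` gap_union E l"
proof -
  have *: "uminus ` gap_union A l \<subseteq> gap_union (uminus ` A) l" for A
  proof
    fix w assume "w \<in> uminus ` gap_union A l"
    then obtain z where z: "z \<in> gap_union A l" "w = - z" by blast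
    obtain u v where uv: "u < z" "z < v" "l \<le> v - u" "{u<..<v} \<inter> A = {}"
      using mem_gap_unionE[OF z(1)] by metis
    have "w \<in> {-v<..<-u}" "l \<le> -u - (-v)" "{-v<..<-u} \<inter> uminus ` A = {}"
      using uv z by (auto simp: disjoint_iff)
    then show "w \<in> gap_union (uminus ` A) l"
      unfolding gap_union_def by blast
  qed
  have "gap_union (uminus ` E) l = uminus ` uminus ` gap_union (uminus ` E) l"
    by (simp add: image_image)
  also have "\<dots> \<subseteq> uminus ` gap_union E l"
    using *[of "uminus ` E"] by (intro image_mono) (simp add: image_image)
  finally show ?thesis using *[of E] by blast
qed

lemma gap_measure_uminus: "gap_measure (uminus ` E) l x y = gap_measure E l (- y) (- x)"
proof -
  have "gap_union (uminus ` E) l \<inter> {x<..<y} = uminus ` (gap_union E l \<inter> {-y<..<-x})"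
    unfolding gap_union_uminus
    by (auto simp: image_iff intro!: bexI[of _ "- z" for z])
  then show ?thesis
    unfolding gap_measure_def
    using measure_lebesgue_affine[of "-1::real" 0 "gap_union E l \<inter> {-y<..<-x}"] by simp
qed

section \<open>Families of disjoint intervals and gap measure\<close>

text \<open>
  Makes the components of a bounded open set of reals candidates for the members of a family.
\<close>
lemma open_connected_bounded_real:
  assumes "open C" "connected C" "bounded C" "C \<noteq> {}"
  shows "bounded_open_interval (C::real set)"
proof -
  have "is_interval C" using assms by (simp add: is_interval_connected_1)
  have bdd: "bdd_below C" "bdd_above C"
    using assms by (auto simp: bounded_imp_bdd_below bounded_imp_bdd_above)
  have "C = {Inf C<..<Sup C}"
  proof (intro equalityI subsetI)
    fix z assume z: "z \<in> C"
    obtain e where e: "e > 0" "cball z e \<subseteq> C" using assms(1) z open_contains_cball by blast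
    then have "z - e \<in> C" "z + e \<in> C" by (auto simp: dist_real_def subset_iff)
    then have "Inf C \<le> z - e" "z + e \<le> Sup C"
      using bdd by (auto intro: cInf_lower cSup_upper)
    then show "z \<in> {Inf C<..<Sup C}" using e by auto
  next
    fix z assume "z \<in> {Inf C<..<Sup C}"
    then obtain u v where "u \<in> C" "u < z" "v \<in> C" "z < v"
      using assms(4) bdd by (auto simp: cInf_less_iff less_cSup_iff)
    then show "z \<in> C" using \<open>is_interval C\<close> unfolding is_interval_1 by (meson less_imp_le)
  qed
  then show ?thesis unfolding bounded_open_interval_def
    using assms(4) by (metis greaterThanLessThan_empty_iff leI)
qed

lemma bounded_open_interval_measurable: "bounded_open_interval J \<Longrightarrow> J \<in> lmeasurable"
  by (auto simp: bounded_open_interval_def)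

lemma disjoint_intervals_Union_measurable:
  assumes "disjoint_intervals_in F A"
  shows "\<Union>F \<in> lmeasurable"
proof (rule fmeasurable.finite_Union)
  show "finite F" using assms unfolding disjoint_intervals_in_def by blast
  show "F \<subseteq> lmeasurable"
    using assms bounded_open_interval_measurable unfolding disjoint_intervals_in_def by blast
qed

lemma sum_disjoint_intervals:
  assumes "disjoint_intervals_in F A"
  shows "(\<Sum>J\<in>F. measure lebesgue J) = measure lebesgue (\<Union>F)"
proof (rule measure_Union'[symmetric])
  show "pairwise disjnt F"
    using assms unfolding disjoint_intervals_in_def by blast
qed (use assms bounded_open_interval_measurable in \<open>auto simp: disjoint_intervals_in_def\<close>)

lemma family_le_gap_measure:
  assumes F: "disjoint_intervals_in F ({x<..<y} - E)"
    and len: "\<And>J. J \<in> F \<Longrightarrow> l \<le> measure lebesgue J"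
  shows "(\<Sum>J\<in>F. measure lebesgue J) \<le> gap_measure E l x y"
proof -
  have "J \<subseteq> gap_union E l \<inter> {x<..<y}" if J: "J \<in> F" for J
  proof -
    obtain u v where uv: "u < v" "J = {u<..<v}"
      using F J unfolding disjoint_intervals_in_def bounded_open_interval_def by blast
    moreover have "l \<le> v - u" using len[OF J] uv by simp
    moreover have "J \<subseteq> {x<..<y} - E" using F J unfolding disjoint_intervals_in_def by blast
    ultimately show ?thesis unfolding gap_union_def by blast
  qed
  then have "\<Union>F \<subseteq> gap_union E l \<inter> {x<..<y}" by blast
  then show ?thesis
    unfolding sum_disjoint_intervals[OF F] gap_measure_def
    using disjoint_intervals_Union_measurable[OF F] fmeasurable_gap_union_Int
    by (intro measure_mono_fmeasurable) (auto dest: fmeasurableD)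
qed

text \<open>
  A component of \<open>gap_union E l \<inter> (x, y)\<close> contains the trace on \<open>(x, y)\<close> of a gap of length at least
  \<open>l\<close>. It can be shorter than \<open>l'\<close> only if the gap is cut by \<open>x\<close> or by \<open>y\<close>, and then its points lie
  within \<open>l'\<close> of that endpoint. So the components of length at least \<open>l'\<close>, finitely many since the interval
  is bounded, miss measure at most \<open>2 * l'\<close>.
\<close>
lemma gap_measure_le_family:
  assumes l': "0 < l'" "l' \<le> l"
  shows "\<exists>F. disjoint_intervals_in F ({x<..<y} - E) \<and> (\<forall>J\<in>F. l' \<le> measure lebesgue J) \<and>
     gap_measure E l x y - 2 * l' \<le> (\<Sum>J\<in>F. measure lebesgue J)"
proof -
  define S where "S = gap_union E l \<inter> {x<..<y}"
  define F where "F = {C \<in> components S. l' \<le> measure lebesgue C}"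
  have opS: "open S" unfolding S_def by (intro open_Int open_gap_union) auto
  have bS: "bounded S" unfolding S_def by (intro bounded_Int) auto
  have SE: "S \<subseteq> {x<..<y} - E" using gap_union_disjoint unfolding S_def by fast
  have comp: "bounded_open_interval C \<and> C \<subseteq> S" if "C \<in> components S" for C
  proof
    show "C \<subseteq> S" by (rule in_components_subset[OF that])
    then have "bounded C" by (rule bounded_subset[OF bS])
    then show "bounded_open_interval C"
      using open_components[OF opS that] in_components_connected[OF that]
        in_components_nonempty[OF that] by (intro open_connected_bounded_real)
  qed
  have dis: "disjoint (components S)"
    using pairwise_disjoint_components[of S] by (auto simp: pairwise_def disjnt_def)
  \<comment> \<open>The finiteness of \<open>F\<close> comes from its finite parts: they are families in the interval, so their
    total length is bounded.\<close>
  have finite_part: "disjoint_intervals_in T ({x<..<y} - E)" if T: "T \<subseteq> F" "finite T" for T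
  proof -
    have "T \<subseteq> components S" using T unfolding F_def by blast
    moreover from this have "disjoint T" using dis by (rule pairwise_subset[rotated])
    ultimately show ?thesis
      using T comp SE unfolding disjoint_intervals_in_def by blast
  qed
  have "finite F"
  proof (rule ccontr)
    assume "infinite F"
    obtain n :: nat where n: "gap_measure E l' x y < n * l'"
      using reals_Archimedean3[OF l'(1)] by blast
    obtain T where T: "T \<subseteq> F" "finite T" "card T = n"
      using infinite_arbitrarily_large[OF \<open>infinite F\<close>] by metis
    have "n * l' \<le> (\<Sum>J\<in>T. measure lebesgue J)"
      using T sum_bounded_below[of T l' "measure lebesgue"] by (auto simp: F_def)
    also have "\<dots> \<le> gap_measure E l' x y"
      using T by (intro family_le_gap_measure finite_part) (auto simp: F_def)
    finally show False using n by simp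
  qed
  then have F: "disjoint_intervals_in F ({x<..<y} - E)" by (rule finite_part[OF order_refl])
  have "S \<subseteq> \<Union>F \<union> ({x<..<x + l'} \<union> {y - l'<..<y})"
  proof
    fix z assume z: "z \<in> S"
    then obtain C where C: "C \<in> components S" "z \<in> C" using Union_components by blast
    show "z \<in> \<Union>F \<union> ({x<..<x + l'} \<union> {y - l'<..<y})"
    proof (cases "C \<in> F")
      case False
      then have small: "measure lebesgue C < l'" using C by (auto simp: F_def)
      obtain u v where uv: "u < z" "z < v" "l \<le> v - u" "{u<..<v} \<subseteq> gap_union E l"
        using z mem_gap_unionE unfolding S_def by (metis IntD1)
      define u' v' where "u' = max u x" and "v' = min v y"
      have zu: "u' < z" "z < v'" using z uv by (auto simp: u'_def v'_def S_def)
      have "{u'<..<v'} \<subseteq> S" using uv by (auto simp: u'_def v'_def S_def)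
      then have "{u'<..<v'} \<subseteq> C"
        using components_maximal[OF C(1), of "{u'<..<v'}"] C(2) zu
        by (metis IntI connected_Ioo emptyE greaterThanLessThan_iff)
      then have "v' - u' \<le> measure lebesgue C"
        using measure_mono_fmeasurable[of "{u'<..<v'}" C lebesgue] comp[OF C(1)] zu
          bounded_open_interval_measurable by auto
      then have "v' - u' < l'" using small by simp
      then have "u' = x \<or> v' = y" using uv l' by (auto simp: u'_def v'_def)
      then show ?thesis using z zu \<open>v' - u' < l'\<close> by (auto simp: S_def)
    qed (use C in auto)
  qed
  moreover have Fm: "\<Union>F \<in> lmeasurable"
    by (rule disjoint_intervals_Union_measurable[OF F])
  ultimately have "measure lebesgue S \<le> measure lebesgue (\<Union>F \<union> ({x<..<x + l'} \<union> {y - l'<..<y}))"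
    using opS by (intro measure_mono_fmeasurable) auto
  also have "\<dots> \<le> measure lebesgue (\<Union>F) + measure lebesgue ({x<..<x + l'} \<union> {y - l'<..<y})"
    using Fm by (intro measure_Un_le) auto
  also have "measure lebesgue ({x<..<x + l'} \<union> {y - l'<..<y})
      \<le> measure lebesgue {x<..<x + l'} + measure lebesgue {y - l'<..<y}"
    by (intro measure_Un_le) auto
  finally have "measure lebesgue S \<le> measure lebesgue (\<Union>F) + 2 * l'"
    using l' by simp
  then have "gap_measure E l x y - 2 * l' \<le> (\<Sum>J\<in>F. measure lebesgue J)"
    unfolding sum_disjoint_intervals[OF F] gap_measure_def S_def by simp
  then show ?thesis using F by (intro exI[of _ F]) (auto simp: F_def)
qed

section \<open>Porosity relative to a translate\<close>

text \<open>
  The three notions of porosity compare an interval with its translate by \<open>\<sigma>\<close> times its length: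
  \<open>\<sigma> = 0\<close> is median porosity, \<open>\<sigma> = -1\<close> its right and \<open>\<sigma> = 1\<close> its left version.
\<close>
definition shift_porous_with :: "real \<Rightarrow> real \<Rightarrow> real \<Rightarrow> real \<Rightarrow> real set \<Rightarrow> bool" where
  "shift_porous_with \<sigma> s t \<delta> E \<longleftrightarrow>
     (\<forall>x h. 0 < h \<longrightarrow>
       (\<exists>F. disjoint_intervals_in F ({x + \<sigma> * h<..<x + h + \<sigma> * h} - E) \<and>
          (\<forall>J\<in>F. \<delta> * L t E {x<..<x + h} \<le> measure lebesgue J) \<and>
          (1 - s) * h \<le> (\<Sum>J\<in>F. measure lebesgue J)))"

lemma median_porous_with_iff_shift: "median_porous_with s t \<delta> E \<longleftrightarrow> shift_porous_with 0 s t \<delta> E"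
proof
  assume M: "median_porous_with s t \<delta> E"
  show "shift_porous_with 0 s t \<delta> E"
    unfolding shift_porous_with_def
  proof (intro allI impI)
    fix x h :: real assume "0 < h"
    then show "\<exists>F. disjoint_intervals_in F ({x + 0 * h<..<x + h + 0 * h} - E) \<and>
          (\<forall>J\<in>F. \<delta> * L t E {x<..<x + h} \<le> measure lebesgue J) \<and>
          (1 - s) * h \<le> (\<Sum>J\<in>F. measure lebesgue J)"
      using M[unfolded median_porous_with_def Let_def, rule_format, of x "x + h"] by simp
  qed
next
  assume M: "shift_porous_with 0 s t \<delta> E"
  show "median_porous_with s t \<delta> E"
    unfolding median_porous_with_def Let_def
  proof (intro allI impI)
    fix a b :: real assume "a < b"
    then show "\<exists>F. disjoint_intervals_in F ({a<..<b} - E) \<and>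
          (\<forall>J\<in>F. \<delta> * L t E {a<..<b} \<le> measure lebesgue J) \<and>
          (1 - s) * measure lebesgue {a<..<b} \<le> (\<Sum>J\<in>F. measure lebesgue J)"
      using M[unfolded shift_porous_with_def, rule_format, of "b - a" a] by simp
  qed
qed

lemma right_median_porous_with_iff_shift:
  "right_median_porous_with s t \<delta> E \<longleftrightarrow> shift_porous_with (- 1) s t \<delta> E"
proof
  assume M: "right_median_porous_with s t \<delta> E"
  show "shift_porous_with (- 1) s t \<delta> E"
    unfolding shift_porous_with_def
  proof (intro allI impI)
    fix x h :: real assume h: "0 < h"
    have "(x - h + (x + h)) / 2 = x" by simp
    then show "\<exists>F. disjoint_intervals_in F ({x + -1 * h<..<x + h + -1 * h} - E) \<and>
          (\<forall>J\<in>F. \<delta> * L t E {x<..<x + h} \<le> measure lebesgue J) \<and>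
          (1 - s) * h \<le> (\<Sum>J\<in>F. measure lebesgue J)"
      using M[unfolded right_median_porous_with_def Let_def, rule_format, of "x - h" "x + h"] h
      by simp
  qed
next
  assume M: "shift_porous_with (- 1) s t \<delta> E"
  show "right_median_porous_with s t \<delta> E"
    unfolding right_median_porous_with_def Let_def
  proof (intro allI impI)
    fix a b :: real assume ab: "a < b"
    have *: "(a + b) / 2 + (b - a) / 2 = b" "(a + b) / 2 + -1 * ((b - a) / 2) = a"
      "b + -1 * ((b - a) / 2) = (a + b) / 2" "(a + b) / 2 - a = (b - a) / 2" "a < (a + b) / 2"
      using ab by (simp_all add: field_simps)
    show "\<exists>F. disjoint_intervals_in F ({a<..<(a + b) / 2} - E) \<and>
          (\<forall>J\<in>F. \<delta> * L t E {(a + b) / 2<..<b} \<le> measure lebesgue J) \<and>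
          (1 - s) * measure lebesgue {a<..<(a + b) / 2} \<le> (\<Sum>J\<in>F. measure lebesgue J)"
      using M[unfolded shift_porous_with_def, rule_format, of "(b - a) / 2" "(a + b) / 2"] ab *(5)
      unfolding *(1-3) measure_interval[OF less_imp_le[OF *(5)]] *(4) by simp
  qed
qed

lemma left_median_porous_with_iff_shift:
  "left_median_porous_with s t \<delta> E \<longleftrightarrow> shift_porous_with 1 s t \<delta> E"
proof
  assume M: "left_median_porous_with s t \<delta> E"
  show "shift_porous_with 1 s t \<delta> E"
    unfolding shift_porous_with_def
  proof (intro allI impI)
    fix x h :: real assume h: "0 < h"
    have *: "(x + (x + 2 * h)) / 2 = x + h" "x + h + 1 * h = x + 2 * h" "x + 1 * h = x + h"
        "measure lebesgue {x + h<..<x + 2 * h} = h"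
      using h by (simp_all add: field_simps)
    have "x < x + 2 * h" using h by simp
    from M[unfolded left_median_porous_with_def Let_def, rule_format, OF this]
    show "\<exists>F. disjoint_intervals_in F ({x + 1 * h<..<x + h + 1 * h} - E) \<and>
          (\<forall>J\<in>F. \<delta> * L t E {x<..<x + h} \<le> measure lebesgue J) \<and>
          (1 - s) * h \<le> (\<Sum>J\<in>F. measure lebesgue J)"
      unfolding * .
  qed
next
  assume M: "shift_porous_with 1 s t \<delta> E"
  show "left_median_porous_with s t \<delta> E"
    unfolding left_median_porous_with_def Let_def
  proof (intro allI impI)
    fix a b :: real assume ab: "a < b"
    have *: "a + (b - a) / 2 = (a + b) / 2" "a + 1 * ((b - a) / 2) = (a + b) / 2"
      "(a + b) / 2 + 1 * ((b - a) / 2) = b" "b - (a + b) / 2 = (b - a) / 2" "(a + b) / 2 < b"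
      using ab by (simp_all add: field_simps)
    show "\<exists>F. disjoint_intervals_in F ({(a + b) / 2<..<b} - E) \<and>
          (\<forall>J\<in>F. \<delta> * L t E {a<..<(a + b) / 2} \<le> measure lebesgue J) \<and>
          (1 - s) * measure lebesgue {(a + b) / 2<..<b} \<le> (\<Sum>J\<in>F. measure lebesgue J)"
      using M[unfolded shift_porous_with_def, rule_format, of "(b - a) / 2" a] ab *(5)
      unfolding *(1-3) measure_interval[OF less_imp_le[OF *(5)]] *(4) by simp
  qed
qed

section \<open>Spreading of gap density\<close>

text \<open>
  Porosity with densities \<open>p = 1 - t\<close>, \<open>q = 1 - s\<close> in place of the parameters \<open>t\<close>, \<open>s\<close>, and with the
  supremum \<open>L\<close> replaced by an arbitrary length \<open>l\<close>. The restriction \<open>l \<le> h\<close> is harmless because \<open>L\<close>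
  never exceeds the length of its interval; it makes a bound that is proportional to \<open>l\<close> also small
  compared with \<open>h\<close>.
\<close>
definition spreads :: "real set \<Rightarrow> real \<Rightarrow> real \<Rightarrow> real \<Rightarrow> bool" where
  "spreads E \<sigma> p q \<longleftrightarrow>
     (\<exists>c>0. c \<le> 1 \<and> (\<forall>x h l. 0 < l \<longrightarrow> l \<le> h \<longrightarrow> p * h \<le> gap_measure E l x (x + h) \<longrightarrow>
        q * h \<le> gap_measure E (c * l) (x + \<sigma> * h) (x + h + \<sigma> * h)))"

lemma spreadsE:
  assumes "spreads E \<sigma> p q"
  obtains c where "0 < c" "c \<le> 1"
    "\<And>x h l. 0 < l \<Longrightarrow> l \<le> h \<Longrightarrow> p * h \<le> gap_measure E l x (x + h) \<Longrightarrow>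
       q * h \<le> gap_measure E (c * l) (x + \<sigma> * h) (x + h + \<sigma> * h)"
  using assms unfolding spreads_def by blast

text \<open>
  If \<open>L\<close> vanishes, porosity still demands a family of large total length, without any control of the
  lengths. This is the part of the condition that \<open>spreads\<close> does not see.
\<close>
definition thick :: "real set \<Rightarrow> real \<Rightarrow> bool" where
  "thick E q \<longleftrightarrow> (\<forall>x h. 0 < h \<longrightarrow> (\<exists>F. disjoint_intervals_in F ({x<..<x + h} - E) \<and>
     q * h \<le> (\<Sum>J\<in>F. measure lebesgue J)))"

lemma shift_porous_imp_thick:
  assumes "shift_porous_with \<sigma> s t \<delta> E"
  shows "thick E (1 - s)"
  unfolding thick_def
proof (intro allI impI)
  fix x h :: real assume "0 < h"
  then show "\<exists>F. disjoint_intervals_in F ({x<..<x + h} - E) \<and>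
      (1 - s) * h \<le> (\<Sum>J\<in>F. measure lebesgue J)"
    using assms[unfolded shift_porous_with_def, rule_format, of h "x - \<sigma> * h"] by auto
qed

lemma thick_mono: "thick E q \<Longrightarrow> q' \<le> q \<Longrightarrow> thick E q'"
  unfolding thick_def by (meson mult_right_mono less_imp_le order_trans)

lemma admissible_lengthD:
  assumes "l \<in> admissible_lengths t E {x<..<x + h}" "0 < h"
  shows "0 < l" "l \<le> h" "(1 - t) * h \<le> gap_measure E l x (x + h)"
proof -
  obtain F where F: "F \<noteq> {}" "disjoint_intervals_in F ({x<..<x + h} - E)"
      "\<And>J. J \<in> F \<Longrightarrow> l \<le> measure lebesgue J"
      "(1 - t) * h \<le> (\<Sum>J\<in>F. measure lebesgue J)" and l: "0 < l"
    using assms unfolding admissible_lengths_def by auto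
  show "0 < l" by (rule l)
  obtain J where J: "J \<in> F" using F(1) by blast
  then have "J \<subseteq> {x<..<x + h}" "J \<in> lmeasurable"
    using F(2) bounded_open_interval_measurable unfolding disjoint_intervals_in_def by blast+
  then have "measure lebesgue J \<le> h"
    using measure_mono_fmeasurable[of J "{x<..<x + h}" lebesgue] assms(2)
    by (auto dest: fmeasurableD)
  then show "l \<le> h" using F(3)[OF J] by simp
  show "(1 - t) * h \<le> gap_measure E l x (x + h)"
    using F(4) family_le_gap_measure[OF F(2,3)] by simp
qed

lemma bdd_above_admissible: "0 < h \<Longrightarrow> bdd_above (admissible_lengths t E {x<..<x + h})"
  using admissible_lengthD(2) by (intro bdd_aboveI) blast

lemma less_LE:
  assumes "l' < L t E {x<..<x + h}" "0 \<le> l'" "0 < h"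
  obtains l where "l' < l" "l \<le> h" "(1 - t) * h \<le> gap_measure E l x (x + h)"
proof -
  have "admissible_lengths t E {x<..<x + h} \<noteq> {}"
    using assms(1,2) unfolding L_def by (auto split: if_splits)
  then obtain l where "l \<in> admissible_lengths t E {x<..<x + h}" "l' < l"
    using assms less_cSup_iff[OF _ bdd_above_admissible[OF assms(3)]]
    unfolding L_def by (auto split: if_splits)
  then show thesis using that admissible_lengthD[OF _ assms(3)] by blast
qed

text \<open>
  The surplus density \<open>\<epsilon>\<close> pays for the gaps that are cut by the endpoints of the interval: those gaps cost
  \<open>2 * (\<epsilon> / 2 * l) \<le> \<epsilon> * h\<close> when intervals of length \<open>\<epsilon> / 2 * l\<close> are kept.
\<close>
lemma le_L_if_gap_measure:
  assumes "0 < \<epsilon>" "\<epsilon> \<le> 1" "t < 1" "0 < l" "l \<le> h"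
    and gap: "(1 - t + \<epsilon>) * h \<le> gap_measure E l x (x + h)"
  shows "\<epsilon> / 2 * l \<le> L t E {x<..<x + h}"
proof -
  have h: "0 < h" using assms by simp
  have pos: "0 < \<epsilon> / 2 * l" "\<epsilon> / 2 * l \<le> l" using assms by auto
  obtain F where F: "disjoint_intervals_in F ({x<..<x + h} - E)"
      "\<forall>J\<in>F. \<epsilon> / 2 * l \<le> measure lebesgue J"
      "gap_measure E l x (x + h) - 2 * (\<epsilon> / 2 * l) \<le> (\<Sum>J\<in>F. measure lebesgue J)"
    using gap_measure_le_family[OF pos] by metis
  have "\<epsilon> * l \<le> \<epsilon> * h" using assms by simp
  then have tot: "(1 - t) * h \<le> (\<Sum>J\<in>F. measure lebesgue J)"
    using F(3) gap by (simp add: algebra_simps)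
  moreover have "0 < (1 - t) * h" using assms h by simp
  ultimately have "F \<noteq> {}" by auto
  then have adm: "\<epsilon> / 2 * l \<in> admissible_lengths t E {x<..<x + h}"
    unfolding admissible_lengths_def using pos F(1,2) tot h by auto
  then have "L t E {x<..<x + h} = Sup (admissible_lengths t E {x<..<x + h})"
    unfolding L_def by auto
  then show ?thesis using cSup_upper[OF adm bdd_above_admissible[OF h]] by simp
qed

text \<open>
  The density in the hypothesis lies halfway between \<open>1 - t\<close> and \<open>1 - s\<close>. This leaves a surplus over
  \<open>1 - t\<close> for passing from gap measure to \<open>L\<close>, and stays below \<open>1 - s\<close>.
\<close>
lemma shift_porous_imp_spreads:
  assumes "shift_porous_with \<sigma> s t \<delta> E" "0 < s" "s < t" "t < 1" "0 < \<delta>" "\<delta> < 1"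
  shows "spreads E \<sigma> (1 - (s + t) / 2) (1 - s)"
proof -
  define \<epsilon> where "\<epsilon> = (t - s) / 2"
  have \<epsilon>: "0 < \<epsilon>" "\<epsilon> \<le> 1" "1 - (s + t) / 2 = 1 - t + \<epsilon>"
    using assms by (auto simp: \<epsilon>_def field_simps)
  define c where "c = \<delta> * (\<epsilon> / 2)"
  have c: "0 < c" "c \<le> 1" using \<epsilon> assms mult_le_one[of \<delta> "\<epsilon> / 2"] by (auto simp: c_def)
  have "(1 - s) * h \<le> gap_measure E (c * l) (x + \<sigma> * h) (x + h + \<sigma> * h)"
    if l: "0 < l" "l \<le> h" "(1 - (s + t) / 2) * h \<le> gap_measure E l x (x + h)" for x h l
  proof -
    have "\<epsilon> / 2 * l \<le> L t E {x<..<x + h}"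
      using l assms \<epsilon> by (intro le_L_if_gap_measure) auto
    then have cl: "c * l \<le> \<delta> * L t E {x<..<x + h}"
      using assms by (simp add: c_def mult.assoc)
    obtain F where F: "disjoint_intervals_in F ({x + \<sigma> * h<..<x + h + \<sigma> * h} - E)"
        "\<forall>J\<in>F. \<delta> * L t E {x<..<x + h} \<le> measure lebesgue J"
        "(1 - s) * h \<le> (\<Sum>J\<in>F. measure lebesgue J)"
      using assms(1) l unfolding shift_porous_with_def by (meson less_le_trans)
    show ?thesis
      using F(3) family_le_gap_measure[OF F(1), of "c * l"] F(2) cl by (meson order_trans)
  qed
  then show ?thesis unfolding spreads_def using c by blast
qed

lemma spreads_imp_shift_porous:
  assumes "spreads E \<sigma> p q" "q' < q" "thick E q'"
  obtains \<delta> where "0 < \<delta>" "\<delta> < 1" "shift_porous_with \<sigma> (1 - q') (1 - p) \<delta> E"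
proof -
  obtain c where c: "0 < c" "c \<le> 1"
    "\<And>x h l. 0 < l \<Longrightarrow> l \<le> h \<Longrightarrow> p * h \<le> gap_measure E l x (x + h) \<Longrightarrow>
       q * h \<le> gap_measure E (c * l) (x + \<sigma> * h) (x + h + \<sigma> * h)"
    using assms(1) by (rule spreadsE) blast
  \<comment> \<open>The loss \<open>2 * \<eta> * (c * l)\<close> at the endpoints must not exceed \<open>(q - q') * h\<close>; the last factor \<open>1 / 2\<close> in
    \<open>\<delta>\<close> compensates for an admissible length that is only more than half the supremum.\<close>
  define \<eta> where "\<eta> = min 1 ((q - q') / 2)"
  have \<eta>: "0 < \<eta>" "\<eta> \<le> 1" "2 * \<eta> \<le> q - q'"
    using assms min.cobounded2[of 1 "(q - q') / 2"] by (auto simp: \<eta>_def)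
  define \<delta> where "\<delta> = \<eta> * c / 2"
  have \<delta>: "0 < \<delta>" "\<delta> < 1"
    using \<eta> c mult_le_one[of \<eta> c] by (auto simp: \<delta>_def)
  have "shift_porous_with \<sigma> (1 - q') (1 - p) \<delta> E"
    unfolding shift_porous_with_def
  proof (intro allI impI)
    fix x h :: real assume h: "0 < h"
    let ?L = "L (1 - p) E {x<..<x + h}"
    show "\<exists>F. disjoint_intervals_in F ({x + \<sigma> * h<..<x + h + \<sigma> * h} - E) \<and>
          (\<forall>J\<in>F. \<delta> * ?L \<le> measure lebesgue J) \<and>
          (1 - (1 - q')) * h \<le> (\<Sum>J\<in>F. measure lebesgue J)"
    proof (cases "0 < ?L")
      case False
      obtain F where F: "disjoint_intervals_in F ({x + \<sigma> * h<..<x + \<sigma> * h + h} - E)"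
          "q' * h \<le> (\<Sum>J\<in>F. measure lebesgue J)"
        using assms(3) h unfolding thick_def by meson
      moreover have "\<delta> * ?L \<le> measure lebesgue J" for J
        using False \<delta> measure_nonneg[of lebesgue J]
        by (meson mult_nonneg_nonpos less_imp_le not_less order_trans)
      ultimately show ?thesis
        by (intro exI[of _ F]) (auto simp: algebra_simps)
    next
      case True
      obtain l where l: "?L / 2 < l" "l \<le> h" "p * h \<le> gap_measure E l x (x + h)"
        by (rule less_LE[of "?L / 2" "1 - p" E x h]) (use True h in auto)
      then have l0: "0 < l" using True by simp
      have gap: "q * h \<le> gap_measure E (c * l) (x + \<sigma> * h) (x + h + \<sigma> * h)"
        by (rule c(3)[OF l0 l(2,3)])
      have l': "0 < \<eta> * (c * l)" "\<eta> * (c * l) \<le> c * l" using \<eta> c l0 by auto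
      obtain F where F: "disjoint_intervals_in F ({x + \<sigma> * h<..<x + h + \<sigma> * h} - E)"
          "\<forall>J\<in>F. \<eta> * (c * l) \<le> measure lebesgue J"
          "gap_measure E (c * l) (x + \<sigma> * h) (x + h + \<sigma> * h) - 2 * (\<eta> * (c * l))
            \<le> (\<Sum>J\<in>F. measure lebesgue J)"
        using gap_measure_le_family[OF l'] by metis
      have "c * l \<le> h" using c l l0 by (metis less_imp_le mult_left_le_one_le order_trans)
      then have "2 * (\<eta> * (c * l)) \<le> 2 * \<eta> * h" using \<eta> by simp
      also have "\<dots> \<le> (q - q') * h" using \<eta> h by (intro mult_right_mono) auto
      finally have "q' * h \<le> (\<Sum>J\<in>F. measure lebesgue J)"
        using F(3) gap by (simp add: algebra_simps)
      moreover have "\<delta> * ?L \<le> measure lebesgue J" if "J \<in> F" for J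
      proof -
        have "\<delta> * ?L = \<eta> * c * (?L / 2)" by (simp add: \<delta>_def)
        also have "\<dots> \<le> \<eta> * c * l" using \<eta> c l by (intro mult_left_mono) auto
        finally show ?thesis using F(2) that by (simp add: mult.assoc) (meson order_trans)
      qed
      ultimately show ?thesis using F(1) by (intro exI[of _ F]) auto
    qed
  qed
  then show thesis using that \<delta> by blast
qed

section \<open>Composing shifts\<close>

lemma spreads_comp:
  assumes "spreads E \<sigma> p q" "spreads E \<tau> p q'" "p \<le> q"
  shows "spreads E (\<sigma> + \<tau>) p q'"
proof -
  obtain c where c: "0 < c" "c \<le> 1"
    "\<And>x h l. 0 < l \<Longrightarrow> l \<le> h \<Longrightarrow> p * h \<le> gap_measure E l x (x + h) \<Longrightarrow>
       q * h \<le> gap_measure E (c * l) (x + \<sigma> * h) (x + h + \<sigma> * h)"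
    using assms(1) by (rule spreadsE) blast
  obtain d where d: "0 < d" "d \<le> 1"
    "\<And>x h l. 0 < l \<Longrightarrow> l \<le> h \<Longrightarrow> p * h \<le> gap_measure E l x (x + h) \<Longrightarrow>
       q' * h \<le> gap_measure E (d * l) (x + \<tau> * h) (x + h + \<tau> * h)"
    using assms(2) by (rule spreadsE) blast
  have "q' * h \<le> gap_measure E (d * c * l) (x + (\<sigma> + \<tau>) * h) (x + h + (\<sigma> + \<tau>) * h)"
    if l: "0 < l" "l \<le> h" "p * h \<le> gap_measure E l x (x + h)" for x h l
  proof -
    have cl: "0 < c * l" "c * l \<le> h"
      using c l by (auto intro: order_trans[OF mult_left_le_one_le])
    have "p * h \<le> q * h" using l assms(3) by (intro mult_right_mono) auto
    also have "\<dots> \<le> gap_measure E (c * l) (x + \<sigma> * h) (x + \<sigma> * h + h)"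
      using c(3)[OF l] by (simp add: ac_simps)
    finally show ?thesis
      using d(3)[OF cl, of "x + \<sigma> * h"] by (simp add: algebra_simps)
  qed
  then show ?thesis
    unfolding spreads_def using c d by (intro exI[of _ "d * c"]) (auto intro: mult_le_one)
qed

text \<open>
  Translating an interval by \<open>\<tau> * h\<close> removes at most \<open>\<bar>\<tau>\<bar> * h\<close> from its gap measure, which the gain
  from \<open>p\<close> to \<open>q\<close> outweighs.
\<close>
lemma spreads_small_shift:
  assumes "spreads E 0 p q" "\<bar>\<tau>\<bar> \<le> q - p"
  shows "spreads E \<tau> p p"
proof -
  obtain c where c: "0 < c" "c \<le> 1"
    "\<And>x h l. 0 < l \<Longrightarrow> l \<le> h \<Longrightarrow> p * h \<le> gap_measure E l x (x + h) \<Longrightarrow>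
       q * h \<le> gap_measure E (c * l) (x + 0 * h) (x + h + 0 * h)"
    using assms(1) by (rule spreadsE) blast
  have "p * h \<le> gap_measure E (c * l) (x + \<tau> * h) (x + h + \<tau> * h)"
    if l: "0 < l" "l \<le> h" "p * h \<le> gap_measure E l x (x + h)" for x h l
  proof -
    let ?m = "gap_measure E (c * l)"
    have h: "0 < h" using l by simp
    have q: "q * h \<le> ?m x (x + h)" using c(3)[OF l] by simp
    also have "\<dots> \<le> ?m (x + \<tau> * h) (x + h + \<tau> * h) + \<bar>\<tau>\<bar> * h"
    proof (cases "0 \<le> \<tau>")
      case True
      then have "0 \<le> \<tau> * h" using h by simp
      then have "?m x (x + h) \<le> ?m x (x + h + \<tau> * h)"
        by (intro gap_measure_subinterval) auto
      also have "\<dots> = ?m x (x + \<tau> * h) + ?m (x + \<tau> * h) (x + h + \<tau> * h)"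
        using \<open>0 \<le> \<tau> * h\<close> h by (intro gap_measure_add) auto
      also have "?m x (x + \<tau> * h) \<le> \<tau> * h"
        using gap_measure_le[of x "x + \<tau> * h"] \<open>0 \<le> \<tau> * h\<close> by simp
      finally show ?thesis using True by simp
    next
      case False
      then have neg: "\<tau> * h \<le> 0" using h by (simp add: mult_nonpos_nonneg)
      then have "?m x (x + h) \<le> ?m (x + \<tau> * h) (x + h)"
        by (intro gap_measure_subinterval) auto
      also have "\<dots> = ?m (x + \<tau> * h) (x + h + \<tau> * h) + ?m (x + h + \<tau> * h) (x + h)"
        using neg h by (intro gap_measure_add) auto
      also have "?m (x + h + \<tau> * h) (x + h) \<le> - \<tau> * h"
        using gap_measure_le[of "x + h + \<tau> * h" "x + h"] neg by simp
      finally show ?thesis using False by simp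
    qed
    finally have "q * h \<le> ?m (x + \<tau> * h) (x + h + \<tau> * h) + \<bar>\<tau>\<bar> * h" .
    moreover have "\<bar>\<tau>\<bar> * h \<le> (q - p) * h" using assms(2) h by (intro mult_right_mono) auto
    ultimately show ?thesis by (simp add: algebra_simps)
  qed
  then show ?thesis unfolding spreads_def using c(1,2) by blast
qed

text \<open>
  Any shift is a composition of finitely many small ones, so a self-improving density propagates to
  translates at any bounded multiple of the length. This gives one-sided porosity from median porosity.
\<close>
lemma spreads_all_shifts:
  assumes "spreads E 0 p q" "p < q"
  shows "spreads E \<sigma> p q"
proof -
  obtain n :: nat where n: "\<bar>\<sigma>\<bar> < n * (q - p)"
    using reals_Archimedean3[of "q - p"] assms(2) by auto
  then have n0: "0 < n" by (cases n) auto
  define \<tau> where "\<tau> = \<sigma> / n"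
  have "\<bar>\<tau>\<bar> \<le> q - p" using n n0 by (simp add: \<tau>_def field_simps)
  then have step: "spreads E \<tau> p p" by (rule spreads_small_shift[OF assms(1)])
  have "spreads E (real k * \<tau>) p q" for k
  proof (induction k)
    case 0 then show ?case using assms by simp
  next
    case (Suc k)
    have "spreads E (\<tau> + real k * \<tau>) p q" by (rule spreads_comp[OF step Suc]) simp
    then show ?case by (simp add: algebra_simps)
  qed
  from this[of n] show ?thesis using n0 by (simp add: \<tau>_def)
qed

text \<open>
  Reflection exchanges left and right; it is used to assume an inequality between the parameters of the
  two one-sided conditions.
\<close>
lemma spreads_uminus:
  assumes "spreads E \<sigma> p q"
  shows "spreads (uminus ` E) (- \<sigma>) p q"
proof -
  obtain c where c: "0 < c" "c \<le> 1"
    "\<And>x h l. 0 < l \<Longrightarrow> l \<le> h \<Longrightarrow> p * h \<le> gap_measure E l x (x + h) \<Longrightarrow>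
       q * h \<le> gap_measure E (c * l) (x + \<sigma> * h) (x + h + \<sigma> * h)"
    using assms(1) by (rule spreadsE) blast
  have "q * h \<le> gap_measure (uminus ` E) (c * l) (x + - \<sigma> * h) (x + h + - \<sigma> * h)"
    if l: "0 < l" "l \<le> h" "p * h \<le> gap_measure (uminus ` E) l x (x + h)" for x h l
  proof -
    have e: "- x - h + h = - x" "- (x + h) = - x - h"
      "- x - h + \<sigma> * h = - (x + h + - \<sigma> * h)" "- x + \<sigma> * h = - (x + - \<sigma> * h)"
      by simp_all
    have "p * h \<le> gap_measure E l (- x - h) (- x - h + h)"
      using l(3) unfolding gap_measure_uminus e(1,2) .
    from c(3)[OF l(1,2) this] show ?thesis
      unfolding gap_measure_uminus e(1) e(3,4) .
  qed
  then show ?thesis unfolding spreads_def using c by blast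
qed

section \<open>Growth of the gap measure by a rising sun argument\<close>

lemma gap_measure_pigeonhole:
  assumes "0 < n" "\<eta> * h \<le> gap_measure E l x (x + h)" "0 < h"
  obtains y where "x \<le> y" "y + h / real n \<le> x + h"
    "\<eta> * (h / real n) \<le> gap_measure E l y (y + h / real n)"
proof -
  define k where "k = h / real n"
  have k: "0 < k" "n * k = h" using assms by (simp_all add: k_def)
  have "\<exists>j<n. \<eta> * k \<le> gap_measure E l (x + j * k) (x + j * k + k)"
  proof (rule ccontr)
    assume "\<not> ?thesis"
    then have small: "gap_measure E l (x + j * k) (x + j * k + k) < \<eta> * k" if "j < n" for j
      using that by (meson not_le)
    have "gap_measure E l x (x + j * k) \<le> j * (\<eta> * k) \<and>
        (0 < j \<longrightarrow> gap_measure E l x (x + j * k) < j * (\<eta> * k))" if "j \<le> n" for j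
      using that
    proof (induction j)
      case 0 then show ?case by (simp add: gap_measure_empty)
    next
      case (Suc j)
      have "x + Suc j * k = x + j * k + k" by (simp add: algebra_simps)
      then have "gap_measure E l x (x + Suc j * k)
          = gap_measure E l x (x + j * k) + gap_measure E l (x + j * k) (x + j * k + k)"
        using k(1) by (simp only:) (intro gap_measure_add; simp)
      also have "\<dots> < j * (\<eta> * k) + \<eta> * k"
        using Suc small[of j] by (intro add_le_less_mono) auto
      finally show ?case by (simp add: distrib_right)
    qed
    from this[of n] have "gap_measure E l x (x + h) < \<eta> * h" using assms k(2) by (simp add: ac_simps)
    then show False using assms(2) by simp
  qed
  then obtain j where j: "j < n" "\<eta> * k \<le> gap_measure E l (x + j * k) (x + j * k + k)"
    by blast
  have "x + j * k + k = x + (j + 1) * k" by (simp add: algebra_simps)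
  also have "(j + 1) * k \<le> n * k"
    using j(1) k(1) by (intro mult_right_mono) auto
  finally have "x + j * k + k \<le> x + h" using k(2) by simp
  then show thesis using that[of "x + j * k"] j k unfolding k_def[symmetric] by simp
qed

text \<open>
  A gap that meets \<open>(-\<infinity>, y)\<close> close to \<open>y\<close> cannot contain \<open>y\<close>, so it ends before \<open>y\<close> and its
  length forces it to begin at or before \<open>y - l\<close>.
\<close>
lemma gap_union_left_of_limit:
  assumes "0 < l" "y \<notin> gap_union E l"
    and cl: "\<And>w. w < y \<Longrightarrow> \<exists>z \<in> gap_union E l. w < z \<and> z < y"
  shows "{y - l<..<y} \<subseteq> gap_union E l"
proof
  fix w assume w: "w \<in> {y - l<..<y}"
  then obtain z where z: "z \<in> gap_union E l" "w < z" "z < y" using cl by auto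
  obtain u v where uv: "u < z" "z < v" "l \<le> v - u" "{u<..<v} \<subseteq> gap_union E l"
    using mem_gap_unionE[OF z(1)] by metis
  have "v \<le> y" using uv z assms(2) by (meson greaterThanLessThan_iff not_le order.strict_trans subsetD)
  then have "w \<in> {u<..<v}" using uv z w by auto
  then show "w \<in> gap_union E l" using uv by blast
qed

text \<open>
  Suppose every terminal part \<open>(z, d)\<close> of \<open>(b, d)\<close> has gap density at least \<open>p\<close>. Cut \<open>(b, d)\<close> at the
  points \<open>z\<^sub>i = d - (d - b) / 2 ^ i\<close>: the piece \<open>(z\<^sub>i, z\<^sub>i\<^sub>+\<^sub>1)\<close> and the terminal part
  \<open>(z\<^sub>i\<^sub>+\<^sub>1, d)\<close> to its right have the same length, so the piece receives density \<open>q\<close>. Only finitely many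
  pieces are used, because the controlled gap length shrinks with the piece.
\<close>
lemma fill_left_of_shadow:
  assumes c: "0 < c" "c \<le> 1"
    "\<And>x h l. 0 < l \<Longrightarrow> l \<le> h \<Longrightarrow> p * h \<le> gap_measure E l x (x + h) \<Longrightarrow>
       q * h \<le> gap_measure E (c * l) (x + -1 * h) (x + h + -1 * h)"
    and l: "0 < l" "l \<le> d - b"
    and dense: "\<And>z. b < z \<Longrightarrow> z < d \<Longrightarrow> p * (d - z) \<le> gap_measure E l z d"
  shows "q * (1 - 1 / 2 ^ n) * (d - b) \<le> gap_measure E (c / 2 ^ n * l) b (d - (d - b) / 2 ^ n)"
proof (induction n)
  case 0 then show ?case by (simp add: gap_measure_nonneg)
next
  case (Suc n)
  define r where "r = (d - b) / 2 ^ n"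
  have r: "0 < r" using l by (simp add: r_def)
  have r': "(d - b) / 2 ^ Suc n = r / 2" "r \<le> d - b"
    using l by (auto simp: r_def divide_le_eq mult_le_cancel_left1)
  have "q * (1 - 1 / 2 ^ n) * (d - b) \<le> gap_measure E (c / 2 ^ Suc n * l) b (d - r)"
    unfolding r_def
    using Suc c l by (intro order_trans[OF Suc] gap_measure_antimono mult_right_mono
      divide_left_mono) auto
  moreover have "q * (r / 2) \<le> gap_measure E (c / 2 ^ Suc n * l) (d - r) (d - r / 2)"
  proof -
    have "l / 2 ^ Suc n \<le> (d - b) / 2 ^ Suc n" using l by (intro divide_right_mono) auto
    then have lr: "0 < l / 2 ^ Suc n" "l / 2 ^ Suc n \<le> r / 2"
      using l by (simp_all only: r'(1)) simp
    have "p * (r / 2) \<le> gap_measure E l (d - r / 2) d"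
      using dense[of "d - r / 2"] r r'(2) by simp
    also have "\<dots> \<le> gap_measure E (l / 2 ^ Suc n) (d - r / 2) d"
      using l divide_left_mono[of 1 "2 ^ Suc n :: real" l]
      by (intro gap_measure_antimono) (simp add: one_le_power del: power_Suc)
    finally have dense': "p * (r / 2) \<le> gap_measure E (l / 2 ^ Suc n) (d - r / 2) d" .
    have e: "d - r / 2 + r / 2 = d" "d - r / 2 + - 1 * (r / 2) = d - r"
      "d + - 1 * (r / 2) = d - r / 2"
      by simp_all
    show ?thesis
      using dense' c(3)[OF lr, of "d - r / 2"] unfolding e by simp
  qed
  ultimately have "q * (1 - 1 / 2 ^ n) * (d - b) + q * (r / 2)
      \<le> gap_measure E (c / 2 ^ Suc n * l) b (d - r / 2)"
    using gap_measure_add[of b "d - r" "d - r / 2"] r r'(2) by simp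
  also have "q * (1 - 1 / 2 ^ n) * (d - b) + q * (r / 2) = q * (1 - 1 / 2 ^ Suc n) * (d - b)"
    by (simp add: r_def field_simps)
  finally show ?case by (simp only: r'(1))
qed

text \<open>
  The gap measure grows by the factor \<open>r\<close>, up to an error, as long as no long subinterval has gap
  density \<open>p\<close>. Let \<open>F x\<close> be the gap measure of \<open>(a, x)\<close> minus \<open>p * (x - a)\<close>, up to a constant. A rising sun
  argument, run from right to left, encloses the gaps in disjoint intervals \<open>(s, d)\<close> with \<open>F s = F d\<close>
  and \<open>F < F d\<close> inside. On such an interval the gap density is exactly \<open>p\<close>, while each terminal part
  has density at least \<open>p\<close>; by filling, shorter gaps occupy at least the proportion
  \<open>q * (1 - 1 / 2 ^ n) \<ge> r * p\<close> of it.

  An interval that would extend beyond \<open>a\<close>, or a gap cut by \<open>b\<close>, is not of this form. It has density at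
  least \<open>p\<close>, hence is shorter than \<open>e\<close> by hypothesis; this is the source of the error \<open>2 * e\<close>.
\<close>
lemma rising_sun_growth:
  assumes c: "0 < c" "c \<le> 1"
    "\<And>x h l. 0 < l \<Longrightarrow> l \<le> h \<Longrightarrow> p * h \<le> gap_measure E l x (x + h) \<Longrightarrow>
       q * h \<le> gap_measure E (c * l) (x + -1 * h) (x + h + -1 * h)"
    and p: "0 < p" "p < 1" and q: "0 \<le> q" and r: "1 \<le> r" "r * p \<le> q * (1 - 1 / 2 ^ n)"
    and l: "0 < l" and e: "0 < e"
    and sparse: "\<And>y k. a \<le> y \<Longrightarrow> y + k \<le> b \<Longrightarrow> e \<le> k \<Longrightarrow> gap_measure E l y (y + k) < p * k"
    and ab: "a < b"
  shows "r * (gap_measure E l a b - 2 * e) \<le> gap_measure E (c / 2 ^ n * l) a b"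
proof -
  define G where "G = gap_union E l"
  define m where "m = gap_measure E l"
  define m' where "m' = gap_measure E (c / 2 ^ n * l)"
  define F where "F z = m a z - p * z" for z
  have opG: "open G" unfolding G_def by (rule open_gap_union)
  have madd: "m x y = m x z + m z y" if "x \<le> z" "z \<le> y" for x y z
    unfolding m_def using that by (rule gap_measure_add)
  have m'add: "m' x y = m' x z + m' z y" if "x \<le> z" "z \<le> y" for x y z
    unfolding m'_def using that by (rule gap_measure_add)
  have mle: "m x y \<le> y - x" if "x \<le> y" for x y unfolding m_def using that by (rule gap_measure_le)
  have m0: "0 \<le> m x y" "0 \<le> m' x y" for x y unfolding m_def m'_def by (rule gap_measure_nonneg)+
  have full: "m x y = y - x" if "{x<..<y} \<subseteq> G" "x \<le> y" for x y
    unfolding m_def using that gap_measure_full by (simp add: G_def)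
  have Fdiff: "F y - F x = m x y - p * (y - x)" if "a \<le> x" "x \<le> y" for x y
    using madd[OF that] by (simp add: F_def algebra_simps)
  have contF: "continuous_on {a..} F"
  proof -
    have "1-lipschitz_on {a..} (m a)"
    proof (rule lipschitz_onI)
      fix x y assume xy: "x \<in> {a..}" "y \<in> {a..}"
      show "dist (m a x) (m a y) \<le> 1 * dist x y"
        using xy madd[of a x y] madd[of a y x] mle[of x y] mle[of y x] m0(1)[of x y] m0(1)[of y x]
        by (cases "x \<le> y") (auto simp: dist_real_def)
    qed simp
    then show ?thesis
      unfolding F_def by (intro continuous_intros lipschitz_on_continuous_on)
  qed
  have slope: "\<exists>z>x. z < w \<and> F x < F z" if x: "x \<in> G" "a \<le> x" "x < w" for x w
  proof -
    obtain \<epsilon> where \<epsilon>: "\<epsilon> > 0" "cball x \<epsilon> \<subseteq> G" using opG x(1) open_contains_cball by blast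
    define z where "z = min (x + \<epsilon>) ((x + w) / 2)"
    have z: "x < z" "z \<le> x + \<epsilon>" "z < w"
      using \<epsilon>(1) x(3) by (auto simp: z_def min_def field_simps)
    have "{x<..<z} \<subseteq> cball x \<epsilon>" using z by (auto simp: dist_real_def)
    then have "m x z = z - x" using \<epsilon> z by (intro full) auto
    then have "F z - F x = (1 - p) * (z - x)" using Fdiff[of x z] x z by (simp add: algebra_simps)
    moreover have "0 < (1 - p) * (z - x)" using p z by simp
    ultimately show ?thesis using z by (intro exI[of _ z]) auto
  qed
  have main: "r * m a y \<le> m' a y + r * e" if "y \<notin> G" "a \<le> y" "y \<le> b" "y - a \<le> real k * l" for y k
    using that
  proof (induction k arbitrary: y)
    case 0
    then have "y = a" by simp
    then show ?case using m0(2)[of a a] r(1) e mle[of a a] m0(1)[of a a] by simp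
  next
    case (Suc k)
    show ?case
    proof (cases "G \<inter> {a<..<y} = {}")
      case True
      then have "m a y = 0" unfolding m_def by (intro gap_measure_empty) (auto simp: G_def)
      then show ?thesis using m0(2)[of a y] r(1) e by simp
    next
      case False
      \<comment> \<open>No point of \<open>G\<close> lies between \<open>d\<close> and \<open>y\<close>.\<close>
      define d where "d = Sup (G \<inter> {a<..<y})"
      have bdd: "bdd_above (G \<inter> {a<..<y})" by (intro bdd_above_Int2) simp
      have d_upper: "z \<le> d" if "z \<in> G" "a < z" "z < y" for z
        unfolding d_def using that by (intro cSup_upper bdd) auto
      have d_le: "d \<le> y" unfolding d_def by (rule cSup_least[OF False]) auto
      have ad: "a < d" using False d_upper by fastforce
      have dG: "d \<notin> G"
      proof
        assume "d \<in> G"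
        then have "d < y" using d_le Suc.prems(1) by (cases "d = y") auto
        obtain \<epsilon> where \<epsilon>: "\<epsilon> > 0" "cball d \<epsilon> \<subseteq> G"
          using opG \<open>d \<in> G\<close> open_contains_cball by blast
        define z where "z = min (d + \<epsilon>) ((d + y) / 2)"
        have z: "d < z" "z \<le> d + \<epsilon>" "z < y"
          using \<epsilon>(1) \<open>d < y\<close> by (auto simp: z_def min_def field_simps)
        then have "z \<in> G" using \<epsilon>(2) by (auto simp: subset_iff dist_real_def)
        then show False using d_upper[of z] z ad by simp
      qed
      have near: "\<exists>z\<in>G. w < z \<and> z < d \<and> a < z" if "w < d" for w
      proof -
        obtain z where "z \<in> G \<inter> {a<..<y}" "w < z"
          using less_cSup_iff[OF False bdd] \<open>w < d\<close> unfolding d_def by blast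
        moreover from this have "z \<le> d" "z \<noteq> d" using d_upper dG by auto
        ultimately show ?thesis by auto
      qed
      \<comment> \<open>A whole gap ends at \<open>d\<close>. Hence the interval that ends at \<open>d\<close> has length at least \<open>l\<close>,
        which bounds the number of steps and lets the filling start with gaps of length \<open>l\<close>.\<close>
      have hole: "{d - l<..<d} \<subseteq> G"
        unfolding G_def
        by (rule gap_union_left_of_limit) (use l dG near in \<open>auto simp: G_def\<close>)
      have mdy: "m d y = 0"
        unfolding m_def using d_upper ad by (intro gap_measure_empty) (force simp: G_def)
      have may: "m a y = m a d" using madd[of a d y] ad d_le mdy by simp
      have m'ay: "m' a d \<le> m' a y" using m'add[of a d y] ad d_le m0(2)[of d y] by simp
      define Z where "Z = {z \<in> {a..d}. F d \<le> F z} - {d}"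
      have Zl: "z \<le> d - l" if "z \<in> Z" for z
      proof (rule ccontr)
        assume "\<not> z \<le> d - l"
        then have z: "a \<le> z" "z < d" "d - l < z" "F d \<le> F z" using that by (auto simp: Z_def)
        then have "m z d = d - z" using hole by (intro full) auto
        then have "F d - F z = (1 - p) * (d - z)" using Fdiff[of z d] z by (simp add: algebra_simps)
        moreover have "0 < (1 - p) * (d - z)" using p z by simp
        ultimately show False using z by simp
      qed
      show ?thesis
      proof (cases "Z = {}")
        case True
        \<comment> \<open>The interval ending at \<open>d\<close> would extend beyond \<open>a\<close>; the whole of \<open>(a, d)\<close> has density above \<open>p\<close>.\<close>
        have "F a < F d" using True ad unfolding Z_def by (auto simp: not_le)
        then have "p * (d - a) \<le> m a d" using Fdiff[of a d] ad by simp
        then have "d - a < e" using sparse[of a "d - a"] d_le Suc.prems by (force simp: m_def)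
        then have "m a y \<le> e" using mle[of a d] ad may by simp
        then have "r * m a y \<le> r * e" using r(1) by (intro mult_left_mono) auto
        then show ?thesis using m0(2)[of a y] by simp
      next
        case False
        \<comment> \<open>The point \<open>s\<close> is the first one to the left of \<open>d\<close> where \<open>F\<close> is again as large as at \<open>d\<close>.\<close>
        define s where "s = Sup Z"
        have bddZ: "bdd_above Z" unfolding Z_def by (rule bdd_aboveI[of _ d]) auto
        have sl: "s \<le> d - l" unfolding s_def by (rule cSup_least[OF False Zl])
        have "Z = {z \<in> {a..d - l}. F d \<le> F z}"
          using Zl l by (auto simp: Z_def)
        moreover have "closed {z \<in> {a..d - l}. F d \<le> F z}"
          using continuous_on_subset[OF contF]
          by (intro continuous_on_closed_Collect_le continuous_on_const) auto
        ultimately have "closed Z" by simp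
        then have "s \<in> Z" unfolding s_def using False bddZ by (intro closed_contains_Sup)
        then have s: "a \<le> s" "F d \<le> F s" by (auto simp: Z_def)
        have above: "F z < F d" if "s < z" "z < d" for z
        proof (rule ccontr)
          assume "\<not> F z < F d"
          then have "z \<in> Z" using that s by (auto simp: Z_def)
          then have "z \<le> s" unfolding s_def using bddZ by (rule cSup_upper)
          then show False using that by simp
        qed
        \<comment> \<open>On \<open>G\<close> the function \<open>F\<close> is strictly increasing.\<close>
        have sG: "s \<notin> G"
        proof
          assume "s \<in> G"
          then obtain z where "s < z" "z < d" "F s < F z" using slope[of s d] s sl l by auto
          then show False using above[of z] s by simp
        qed
        have "F s \<le> F d"
        proof (rule continuous_le_on_closure[where S = "{s<..<d}" and f = F])
        qed (use sl l s above contF in \<open>auto intro: continuous_on_subset less_imp_le\<close>)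
        then have Feq: "F s = F d" using s by simp
        have msd: "m s d = p * (d - s)" using Fdiff[of s d] Feq s sl l by simp
        have fill: "q * (1 - 1 / 2 ^ n) * (d - s) \<le> m' s d"
        proof -
          have "q * (1 - 1 / 2 ^ n) * (d - s)
              \<le> gap_measure E (c / 2 ^ n * l) s (d - (d - s) / 2 ^ n)"
          proof (rule fill_left_of_shadow[OF c l])
            show "p * (d - z) \<le> gap_measure E l z d" if "s < z" "z < d" for z
              using above[OF that] Fdiff[of z d] that s by (simp add: m_def)
          qed (use sl in auto)
          also have "\<dots> \<le> m' s d"
            unfolding m'_def using sl l by (intro gap_measure_subinterval) auto
          finally show ?thesis .
        qed
        have "r * m s d \<le> m' s d"
        proof -
          have "r * m s d = r * p * (d - s)" using msd by simp
          also have "\<dots> \<le> q * (1 - 1 / 2 ^ n) * (d - s)"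
            using r sl l by (intro mult_right_mono) auto
          finally show ?thesis using fill by simp
        qed
        moreover have "r * m a s \<le> m' a s + r * e"
          using Suc.prems sl l d_le s sG by (intro Suc.IH) (auto simp: algebra_simps)
        moreover have "m a d = m a s + m s d" "m' a d = m' a s + m' s d"
          using madd[of a s d] m'add[of a s d] s sl l by auto
        ultimately show ?thesis using may m'ay by (simp add: distrib_left)
      qed
    qed
  qed
  \<comment> \<open>The induction starts at a point outside \<open>G\<close>. If \<open>b\<close> lies in a gap, the part of the gap before \<open>b\<close>
    has density one and must be short.\<close>
  have tail: "m y b \<le> e" if "a \<le> y" "y \<le> b" "{y<..<b} \<subseteq> G" for y
  proof (rule ccontr)
    assume "\<not> m y b \<le> e"
    moreover have myb: "m y b = b - y" using that by (intro full) auto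
    ultimately have "b - y < p * (b - y)" using sparse[of y "b - y"] that by (simp add: m_def)
    moreover have "p * (b - y) \<le> 1 * (b - y)" using p that by (intro mult_right_mono) auto
    ultimately show False by simp
  qed
  show ?thesis
  proof (cases "{a..b} \<subseteq> G")
    case True
    then have "m a b \<le> e" using ab by (intro tail) auto
    then have "m a b - 2 * e \<le> 0" using e by simp
    then have "r * (m a b - 2 * e) \<le> 0" using r(1) by (simp add: mult_nonneg_nonpos)
    then show ?thesis using m0(2)[of a b] unfolding m_def m'_def by simp
  next
    case False
    define y where "y = Sup ({a..b} - G)"
    have bdd: "bdd_above ({a..b} - G)" by (rule bdd_aboveI[of _ b]) auto
    have ne: "{a..b} - G \<noteq> {}" using False by blast
    have "closed ({a..b} - G)" using opG by (intro closed_Diff) auto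
    then have "y \<in> {a..b} - G" unfolding y_def using ne bdd by (intro closed_contains_Sup)
    then have y: "y \<notin> G" "a \<le> y" "y \<le> b" by auto
    have "z \<in> G" if "y < z" "z < b" for z
    proof (rule ccontr)
      assume "z \<notin> G"
      then have "z \<le> y" unfolding y_def using that y bdd by (intro cSup_upper) auto
      then show False using that by simp
    qed
    then have myb: "m y b \<le> e" using y by (intro tail) auto
    obtain k :: nat where "y - a < k * l" using reals_Archimedean3[OF l] by blast
    then have "r * m a y \<le> m' a y + r * e" by (intro main[of y k] y) simp
    moreover have "m' a y \<le> m' a b" using m'add[of a y b] y m0(2)[of y b] by simp
    moreover have "r * m a b \<le> r * m a y + r * e"
      using madd[of a y b] y myb r(1) by (simp flip: distrib_left)
    ultimately show ?thesis unfolding m_def m'_def by (simp add: algebra_simps)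
  qed
qed

section \<open>Condensation of gap density\<close>

text \<open>
  Gap density \<open>\<eta>\<close> on an interval yields gap density \<open>p\<close>, for gaps shorter by a bounded factor, on a
  subinterval whose length is comparable to that of the whole. The point is the case \<open>\<eta> < p\<close>.
\<close>
definition condenses :: "real set \<Rightarrow> real \<Rightarrow> real \<Rightarrow> bool" where
  "condenses E p \<eta> \<longleftrightarrow>
     (\<exists>e>0. e \<le> 1 \<and> (\<exists>c>0. c \<le> 1 \<and>
       (\<forall>x h l. 0 < l \<longrightarrow> l \<le> h \<longrightarrow> \<eta> * h \<le> gap_measure E l x (x + h) \<longrightarrow>
         (\<exists>y k. x \<le> y \<and> y + k \<le> x + h \<and> e * h \<le> k \<and> p * k \<le> gap_measure E (c * l) y (y + k)))))"

lemma mult_le_of_le_one: "0 \<le> c \<Longrightarrow> c \<le> 1 \<Longrightarrow> 0 \<le> l \<Longrightarrow> l \<le> h \<Longrightarrow> c * l \<le> (h::real)"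
  using mult_left_le_one_le[of l c] by linarith

lemma condensesI:
  assumes "0 < e" "e \<le> 1" "0 < c" "c \<le> 1"
    "\<And>x h l. 0 < l \<Longrightarrow> l \<le> h \<Longrightarrow> \<eta> * h \<le> gap_measure E l x (x + h) \<Longrightarrow>
       \<exists>y k. x \<le> y \<and> y + k \<le> x + h \<and> e * h \<le> k \<and> p * k \<le> gap_measure E (c * l) y (y + k)"
  shows "condenses E p \<eta>"
  unfolding condenses_def using assms by blast

lemma condenses_refl: "condenses E p p"
proof (rule condensesI[of 1 1])
  fix x h l assume "0 < l" "l \<le> h" "p * h \<le> gap_measure E l x (x + h)"
  then show "\<exists>y k. x \<le> y \<and> y + k \<le> x + h \<and> 1 * h \<le> k \<and> p * k \<le> gap_measure E (1 * l) y (y + k)"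
    by (intro exI[of _ x] exI[of _ h]) simp
qed auto

lemma condenses_mono:
  assumes "condenses E p \<eta>" "\<eta> \<le> \<eta>'"
  shows "condenses E p \<eta>'"
proof -
  have "\<eta> * h \<le> gap_measure E l x (x + h)"
    if "0 < l" "l \<le> h" "\<eta>' * h \<le> gap_measure E l x (x + h)" for x h l
    using that mult_right_mono[OF assms(2), of h] by linarith
  then show ?thesis
    using assms(1) unfolding condenses_def by meson
qed

text \<open>
  Either a subinterval of relative length \<open>\<epsilon>\<close> already has density \<open>p\<close>, or the growth lemma raises the
  density from \<open>\<eta> / \<rho>\<close> back to \<open>\<eta>\<close>. The ratio \<open>\<rho> = (1 + r) / 2\<close> lies strictly between \<open>1\<close> and \<open>r\<close>;
  the difference absorbs the error of the growth lemma.
\<close>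
lemma condenses_step:
  assumes c: "0 < c" "c \<le> 1"
    "\<And>x h l. 0 < l \<Longrightarrow> l \<le> h \<Longrightarrow> p * h \<le> gap_measure E l x (x + h) \<Longrightarrow>
       q * h \<le> gap_measure E (c * l) (x + -1 * h) (x + h + -1 * h)"
    and p: "0 < p" "p < 1" and q: "0 \<le> q" and r: "1 < r" "r * p \<le> q * (1 - 1 / 2 ^ n)"
    and \<eta>: "0 < \<eta>" and cond: "condenses E p \<eta>"
  shows "condenses E p (\<eta> / ((1 + r) / 2))"
proof -
  define \<rho> where "\<rho> = (1 + r) / 2"
  have \<rho>: "1 < \<rho>" "\<rho> < r" using r by (auto simp: \<rho>_def)
  define \<epsilon> where "\<epsilon> = min 1 (\<eta> * (1 / \<rho> - 1 / r) / 2)"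
  have "0 < 1 / \<rho> - 1 / r" using \<rho> by (simp add: frac_less2)
  then have "0 < \<eta> * (1 / \<rho> - 1 / r) / 2" using \<eta> by simp
  then have \<epsilon>: "0 < \<epsilon>" "\<epsilon> \<le> 1" "2 * \<epsilon> \<le> \<eta> * (1 / \<rho> - 1 / r)"
    unfolding \<epsilon>_def using min.cobounded2[of 1 "\<eta> * (1 / \<rho> - 1 / r) / 2"] by auto
  have "r * (2 * \<epsilon>) \<le> r * (\<eta> * (1 / \<rho> - 1 / r))"
    using \<epsilon>(3) \<rho> by (intro mult_left_mono) auto
  also have "\<dots> = r * (\<eta> / \<rho>) - \<eta>" using \<rho> by (simp add: field_simps)
  finally have grow: "\<eta> \<le> r * (\<eta> / \<rho> - 2 * \<epsilon>)" by (simp add: algebra_simps)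
  define c' where "c' = c / 2 ^ n"
  have c': "0 < c'" "c' \<le> 1"
    using c one_le_power[of 2 n] by (auto simp: c'_def divide_le_eq intro: order_trans)
  obtain e d where e: "0 < e" "e \<le> 1" and d: "0 < d" "d \<le> 1" and
    ed: "\<And>x h l. 0 < l \<Longrightarrow> l \<le> h \<Longrightarrow> \<eta> * h \<le> gap_measure E l x (x + h) \<Longrightarrow>
       \<exists>y k. x \<le> y \<and> y + k \<le> x + h \<and> e * h \<le> k \<and> p * k \<le> gap_measure E (d * l) y (y + k)"
    using cond unfolding condenses_def by blast
  have "\<exists>y k. x \<le> y \<and> y + k \<le> x + h \<and> min \<epsilon> e * h \<le> k \<and>
          p * k \<le> gap_measure E (d * c' * l) y (y + k)"
    if l: "0 < l" "l \<le> h" and gap: "\<eta> / \<rho> * h \<le> gap_measure E l x (x + h)" for x h l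
  proof (cases "\<exists>y k. x \<le> y \<and> y + k \<le> x + h \<and> \<epsilon> * h \<le> k \<and> p * k \<le> gap_measure E l y (y + k)")
    case True
    then obtain y k where yk: "x \<le> y" "y + k \<le> x + h" "\<epsilon> * h \<le> k" "p * k \<le> gap_measure E l y (y + k)"
      by blast
    have "d * c' * l \<le> l" using mult_le_one[of d c'] c' d l by (simp add: mult_left_le_one_le)
    then have "p * k \<le> gap_measure E (d * c' * l) y (y + k)"
      using yk(4) gap_measure_antimono order_trans by blast
    moreover have "min \<epsilon> e * h \<le> k"
    proof -
      have "min \<epsilon> e * h \<le> \<epsilon> * h" using l by (intro mult_right_mono) auto
      then show ?thesis using yk(3) by simp
    qed
    ultimately show ?thesis using yk by blast
  next
    case False
    have "r * (gap_measure E l x (x + h) - 2 * (\<epsilon> * h)) \<le> gap_measure E (c / 2 ^ n * l) x (x + h)"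
    proof (rule rising_sun_growth[where p = p and q = q])
      show "gap_measure E l y (y + k) < p * k"
        if "x \<le> y" "y + k \<le> x + h" "\<epsilon> * h \<le> k" for y k
        using False that by (meson not_le)
    qed (use c p q r l \<epsilon> in auto)
    moreover have "\<eta> * h \<le> r * (gap_measure E l x (x + h) - 2 * (\<epsilon> * h))"
    proof -
      have "\<eta> * h \<le> r * (\<eta> / \<rho> - 2 * \<epsilon>) * h" using grow l by (intro mult_right_mono) auto
      also have "\<dots> = r * (\<eta> / \<rho> * h - 2 * (\<epsilon> * h))" by (simp add: algebra_simps)
      also have "\<dots> \<le> r * (gap_measure E l x (x + h) - 2 * (\<epsilon> * h))"
        using gap r by (intro mult_left_mono) auto
      finally show ?thesis .
    qed
    ultimately have "\<eta> * h \<le> gap_measure E (c' * l) x (x + h)" by (simp add: c'_def)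
    moreover have "0 < c' * l" "c' * l \<le> h"
      using c' l by (auto intro!: mult_le_of_le_one)
    ultimately obtain y k where "x \<le> y" "y + k \<le> x + h" "e * h \<le> k"
        "p * k \<le> gap_measure E (d * (c' * l)) y (y + k)"
      using ed by blast
    moreover have "min \<epsilon> e * h \<le> e * h" using l by (intro mult_right_mono) auto
    ultimately show ?thesis by (intro exI[of _ y] exI[of _ k]) (auto simp: mult.assoc)
  qed
  moreover have "0 < min \<epsilon> e" "min \<epsilon> e \<le> 1" "0 < d * c'" "d * c' \<le> 1"
    using \<epsilon> e d c' by (auto intro: mult_le_one)
  ultimately show ?thesis unfolding \<rho>_def[symmetric] by (intro condensesI)
qed

text \<open>
  A finite iteration reaches every positive density, since the admissible density drops by a fixed
  factor \<open>\<rho> > 1\<close> at each step.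
\<close>
lemma spreads_left_imp_condenses:
  assumes "spreads E (- 1) p q" "0 < p" "p < 1" "p < q" "0 < \<eta>"
  shows "condenses E p \<eta>"
proof -
  obtain c where c: "0 < c" "c \<le> 1"
    "\<And>x h l. 0 < l \<Longrightarrow> l \<le> h \<Longrightarrow> p * h \<le> gap_measure E l x (x + h) \<Longrightarrow>
       q * h \<le> gap_measure E (c * l) (x + -1 * h) (x + h + -1 * h)"
    using assms(1) by (rule spreadsE) blast
  obtain n :: nat where n: "(1 / 2 :: real) ^ n < 1 - p / q"
    using real_arch_pow_inv[of "1 - p / q" "1 / 2"] assms by auto
  define r where "r = q * (1 - 1 / 2 ^ n) / p"
  have "p < q * (1 - 1 / 2 ^ n)" using n assms by (simp add: field_simps power_one_over)
  then have r: "1 < r" "r * p \<le> q * (1 - 1 / 2 ^ n)" using assms by (auto simp: r_def)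
  define \<rho> where "\<rho> = (1 + r) / 2"
  have \<rho>: "1 < \<rho>" using r by (simp add: \<rho>_def)
  have iter: "condenses E p (p / \<rho> ^ k)" for k
  proof (induction k)
    case 0 show ?case by (simp add: condenses_refl)
  next
    case (Suc k)
    have "condenses E p (p / \<rho> ^ k / \<rho>)"
      unfolding \<rho>_def
    proof (rule condenses_step[OF c])
      show "0 < p / ((1 + r) / 2) ^ k" using assms r by simp
      show "condenses E p (p / ((1 + r) / 2) ^ k)" using Suc by (simp only: \<rho>_def)
    qed (use assms r in auto)
    then show ?case by (simp add: mult.commute)
  qed
  obtain k where "p / \<eta> < \<rho> ^ k" using real_arch_pow[OF \<rho>] by blast
  then have "p / \<rho> ^ k \<le> \<eta>" using assms \<rho> by (simp add: field_simps)
  then show ?thesis using condenses_mono iter by blast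
qed

section \<open>Combining the two one-sided conditions\<close>

text \<open>
  Since \<open>q \<ge> p\<close>, each tile serves as the source for the next one; the gap length loses a factor \<open>c\<close>
  per tile.
\<close>
lemma tile_to_the_left:
  assumes c: "0 < c" "c \<le> 1"
    "\<And>x h l. 0 < l \<Longrightarrow> l \<le> h \<Longrightarrow> p * h \<le> gap_measure E l x (x + h) \<Longrightarrow>
       q * h \<le> gap_measure E (c * l) (x + -1 * h) (x + h + -1 * h)"
    and pq: "p \<le> q" and l: "0 < l" "l \<le> k" and gap: "p * k \<le> gap_measure E l y (y + k)"
  shows "p * k \<le> gap_measure E (c ^ n * l) (y - n * k) (y - n * k + k)"
    and "n * (q * k) \<le> gap_measure E (c ^ n * l) (y - n * k) y"
proof (induction n)
  case 0
  { case 1 show ?case using gap by simp }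
  { case 2 show ?case by (simp add: gap_measure_nonneg) }
next
  case (Suc n)
  have k: "0 < k" using l by simp
  have cl: "0 < c ^ n * l" "c ^ n * l \<le> k"
    using c l by (auto intro!: mult_le_of_le_one power_le_one)
  have e: "y - n * k + -1 * k = y - Suc n * k" "y - n * k + k + -1 * k = y - n * k"
    "c * (c ^ n * l) = c ^ Suc n * l" "y - Suc n * k + k = y - n * k"
    by (simp_all add: algebra_simps)
  have new: "q * k \<le> gap_measure E (c ^ Suc n * l) (y - Suc n * k) (y - n * k)"
    using c(3)[OF cl Suc(1)] unfolding e .
  have "p * k \<le> q * k" using pq k by (intro mult_right_mono) auto
  { case 1 show ?case using new \<open>p * k \<le> q * k\<close> unfolding e by simp }
  { case 2
    have "n * (q * k) \<le> gap_measure E (c ^ Suc n * l) (y - n * k) y"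
      using cl c by (intro order_trans[OF Suc(2)] gap_measure_antimono)
        (auto simp: mult.assoc mult_left_le_one_le)
    moreover have "gap_measure E (c ^ Suc n * l) (y - Suc n * k) y
        = gap_measure E (c ^ Suc n * l) (y - Suc n * k) (y - n * k)
          + gap_measure E (c ^ Suc n * l) (y - n * k) y"
      using k by (intro gap_measure_add) (auto simp: algebra_simps)
    ultimately show ?case using new by (simp add: algebra_simps) }
qed

text \<open>
  Let \<open>J\<close> have gap density \<open>p'\<close>. Its right neighbour then has density \<open>q' > 0\<close>, possibly below the
  threshold \<open>p\<close> of the condition that leads back to the left. Condensation repairs this: the neighbour
  contains an interval of length comparable to \<open>J\<close> and density \<open>p\<close>. Its translates to the left tile \<open>J\<close>
  and have density \<open>q\<close>. The tiles at the ends of \<open>J\<close> are lost, so the interval is sought inside a short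
  cell of the neighbour, whose length \<open>h / n\<close> keeps this loss below \<open>(q - Q) * h\<close>.
\<close>
lemma spreads_left_right_combine:
  assumes left: "spreads E (- 1) p q" and right: "spreads E 1 p' q'"
    and "0 < p" "p < q" "q < 1" "0 < q'" "Q < q"
  shows "spreads E 0 p' Q"
proof -
  obtain c where c: "0 < c" "c \<le> 1"
    "\<And>x h l. 0 < l \<Longrightarrow> l \<le> h \<Longrightarrow> p * h \<le> gap_measure E l x (x + h) \<Longrightarrow>
       q * h \<le> gap_measure E (c * l) (x + -1 * h) (x + h + -1 * h)"
    using left by (rule spreadsE) blast
  obtain d where d: "0 < d" "d \<le> 1"
    "\<And>x h l. 0 < l \<Longrightarrow> l \<le> h \<Longrightarrow> p' * h \<le> gap_measure E l x (x + h) \<Longrightarrow>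
       q' * h \<le> gap_measure E (d * l) (x + 1 * h) (x + h + 1 * h)"
    using right by (rule spreadsE) blast
  have "condenses E p q'" using assms by (intro spreads_left_imp_condenses[OF left]) auto
  then obtain e b where e: "0 < e" "e \<le> 1" and b: "0 < b" "b \<le> 1" and
    eb: "\<And>x h l. 0 < l \<Longrightarrow> l \<le> h \<Longrightarrow> q' * h \<le> gap_measure E l x (x + h) \<Longrightarrow>
       \<exists>y k. x \<le> y \<and> y + k \<le> x + h \<and> e * h \<le> k \<and> p * k \<le> gap_measure E (b * l) y (y + k)"
    unfolding condenses_def by blast
  obtain n :: nat where n: "2 < n * (q - Q)" using reals_Archimedean3[of "q - Q"] assms by auto
  then have n0: "0 < n" by (cases n) auto
  \<comment> \<open>The tiles have length at least \<open>e * h / n\<close> and lie in an interval of length \<open>2 * h\<close>, so \<open>N\<close>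
    bounds their number.\<close>
  obtain N :: nat where N: "2 * n / e \<le> N" using real_arch_simple by blast
  define C where "C = c ^ N * (e * b * d / n)"
  have C: "0 < C" "C \<le> 1"
  proof -
    show "0 < C" using c e b d n0 by (simp add: C_def)
    have "e * b * d / n \<le> e * b * d / 1" using e b d n0 by (intro divide_left_mono) auto
    also have "\<dots> \<le> 1" using e b d by (auto intro!: mult_le_one)
    finally show "C \<le> 1" unfolding C_def
      using c e b d by (intro mult_le_one power_le_one) auto
  qed
  have "Q * h \<le> gap_measure E (C * l) x (x + h)"
    if l: "0 < l" "l \<le> h" and gap: "p' * h \<le> gap_measure E l x (x + h)" for x h l
  proof -
    have h: "0 < h" using l by simp
    have "q' * h \<le> gap_measure E (d * l) (x + h) (x + h + h)"
      using d(3)[OF l gap] by simp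
    from gap_measure_pigeonhole[OF n0 this h]
    obtain y1 where y1: "x + h \<le> y1" "y1 + h / n \<le> x + h + h"
        "q' * (h / n) \<le> gap_measure E (d * l) y1 (y1 + h / n)" by metis
    define l1 where "l1 = d * l / n"
    have "d * l \<le> h" using d l by (auto intro!: mult_le_of_le_one)
    then have "l1 \<le> h / n" unfolding l1_def by (intro divide_right_mono) auto
    moreover have "l1 \<le> d * l / 1"
      unfolding l1_def using d l n0 by (intro divide_left_mono) auto
    ultimately have l1: "0 < l1" "l1 \<le> h / n" "l1 \<le> d * l"
      using d l n0 by (auto simp: l1_def)
    have "q' * (h / n) \<le> gap_measure E l1 y1 (y1 + h / n)"
      using y1(3) gap_measure_antimono[OF l1(3)] order_trans by blast
    then obtain y k where yk: "y1 \<le> y" "y + k \<le> y1 + h / n" "e * (h / n) \<le> k"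
        "p * k \<le> gap_measure E (b * l1) y (y + k)"
      using eb[OF l1(1,2)] by blast
    have k: "0 < k" using yk(3) e h n0 by (auto intro: less_le_trans[rotated])
    have kh: "k \<le> h / n" using yk(1,2) by simp
    define l2 where "l2 = e * b * l1"
    have l2: "0 < l2" using e b l1 by (simp add: l2_def)
    have "b * l1 \<le> h / n" using b l1 by (auto intro!: mult_le_of_le_one)
    then have "l2 \<le> e * (h / n)" using e by (simp add: l2_def mult.assoc del: times_divide_eq_right)
    then have l2k: "l2 \<le> k" using yk(3) by simp
    have "l2 \<le> b * l1" using e b l1 by (simp add: l2_def mult.assoc mult_left_le_one_le)
    then have gap2: "p * k \<le> gap_measure E l2 y (y + k)"
      using yk(4) gap_measure_antimono order_trans by blast
    \<comment> \<open>The first \<open>i\<close> translations bring the left end \<open>z\<close> of the tile to within \<open>k\<close> of the right end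
      \<open>x + h\<close>; the next \<open>j\<close> tiles are those contained in \<open>(x, z)\<close>.\<close>
    define i where "i = nat \<lceil>(y - (x + h)) / k\<rceil>"
    define z where "z = y - i * k"
    have i: "(y - (x + h)) / k \<le> i" "i < (y - (x + h)) / k + 1"
      using yk(1) y1(1) k by (auto simp: i_def) linarith+
    then have z: "z \<le> x + h" "x + h - k < z"
      using k by (auto simp: z_def field_simps)
    have cl: "0 < c ^ i * l2" "c ^ i * l2 \<le> k"
      using c l2 l2k by (auto intro!: mult_le_of_le_one power_le_one)
    have zgap: "p * k \<le> gap_measure E (c ^ i * l2) z (z + k)"
      unfolding z_def using assms by (intro tile_to_the_left(1)[OF c _ l2 l2k gap2]) auto
    have "h / n \<le> h" using n0 h by (simp add: divide_le_eq mult_le_cancel_left1)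
    then have xz: "x \<le> z" using z kh by simp
    define j where "j = nat \<lfloor>(z - x) / k\<rfloor>"
    have j: "j \<le> (z - x) / k" "(z - x) / k < j + 1"
      using xz k by (auto simp: j_def) linarith
    then have zj: "x \<le> z - j * k" "z - j * k < x + k"
      using k by (auto simp: field_simps)
    have zgap2: "j * (q * k) \<le> gap_measure E (c ^ j * (c ^ i * l2)) (z - j * k) z"
      using assms by (intro tile_to_the_left(2)[OF c _ cl zgap]) auto
    have "(i + j) * k \<le> 2 * h"
      using zj(1) yk(2) y1(2) k by (simp add: z_def algebra_simps)
    then have "(i + j) * (e * (h / n)) \<le> 2 * h"
      using mult_left_mono[OF yk(3), of "real (i + j)"] by simp
    then have "((i + j) * e / n) * h \<le> 2 * h" by (simp add: mult_ac)
    then have "(i + j) * e / n \<le> 2" using h by (rule mult_right_le_imp_le)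
    then have "(i + j) \<le> 2 * n / e" using e n0 by (simp add: field_simps)
    then have ij: "i + j \<le> N" using N by (metis of_nat_le_iff order_trans)
    have "C * l = c ^ N * l2" by (simp add: C_def l2_def l1_def)
    also have "\<dots> \<le> c ^ (i + j) * l2"
      using c l2 ij by (intro mult_right_mono power_decreasing) auto
    finally have Cl: "C * l \<le> c ^ j * (c ^ i * l2)" by (simp add: power_add mult_ac)
    have "2 * k \<le> (q - Q) * h"
    proof -
      have "2 * k \<le> 2 / n * h" using kh by simp
      also have "\<dots> \<le> (q - Q) * h" using n n0 h by (intro mult_right_mono) (auto simp: field_simps)
      finally show ?thesis .
    qed
    moreover have "q * (2 * k) \<le> 2 * k" using assms k by (simp add: mult_left_le_one_le)
    ultimately have "Q * h \<le> q * (h - 2 * k)" by (simp add: algebra_simps)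
    also have "\<dots> \<le> q * (j * k)" using zj z assms by (intro mult_left_mono) auto
    also have "\<dots> \<le> gap_measure E (c ^ j * (c ^ i * l2)) (z - j * k) z"
      using zgap2 by (simp add: mult_ac)
    also have "\<dots> \<le> gap_measure E (C * l) (z - j * k) z" by (rule gap_measure_antimono[OF Cl])
    also have "\<dots> \<le> gap_measure E (C * l) x (x + h)"
      using zj z by (intro gap_measure_subinterval) auto
    finally show ?thesis .
  qed
  then show ?thesis unfolding spreads_def using C by (intro exI[of _ C]) auto
qed

lemma spreads_imp_shift_porous_params:
  assumes "spreads E \<sigma> p q" "thick E q" "0 < p" "p < q" "q < 1"
  shows "\<exists>s t \<delta>. 0 < s \<and> s < t \<and> t < 1 \<and> 0 < \<delta> \<and> \<delta> < 1 \<and> shift_porous_with \<sigma> s t \<delta> E"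
proof -
  define q' where "q' = (p + q) / 2"
  have q': "p < q'" "q' < q" using assms by (auto simp: q'_def)
  obtain \<delta> where "0 < \<delta>" "\<delta> < 1" "shift_porous_with \<sigma> (1 - q') (1 - p) \<delta> E"
    using spreads_imp_shift_porous[OF assms(1) q'(2) thick_mono[OF assms(2)]] q' by auto
  then show ?thesis using q' assms
    by (intro exI[of _ "1 - q'"] exI[of _ "1 - p"] exI[of _ \<delta>]) auto
qed

lemma shift_porous_paramsE:
  assumes "\<exists>s t \<delta>. 0 < s \<and> s < t \<and> t < 1 \<and> 0 < \<delta> \<and> \<delta> < 1 \<and> shift_porous_with \<sigma> s t \<delta> E"
  obtains p q where "0 < p" "p < q" "q < 1" "spreads E \<sigma> p q" "thick E q"
proof -
  obtain s t \<delta> where st: "0 < s" "s < t" "t < 1" "0 < \<delta>" "\<delta> < 1" "shift_porous_with \<sigma> s t \<delta> E"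
    using assms by blast
  show thesis
  proof (rule that)
    show "spreads E \<sigma> (1 - (s + t) / 2) (1 - s)"
      using st by (intro shift_porous_imp_spreads)
    show "thick E (1 - s)" using st(6) by (rule shift_porous_imp_thick)
  qed (use st in auto)
qed

text \<open>
  For the converse, condensation is needed only on one side, and the sides are exchanged by reflection.
  Going to the right neighbour and back turns density \<open>p'\<close> into nearly \<open>q\<close>, a gain if \<open>p' < q\<close>.
  Otherwise \<open>p < q \<le> p' < q'\<close>, and going to the left neighbour first turns \<open>p\<close> into nearly \<open>q'\<close>.
\<close>
theorem proposition5p1:
  fixes E :: "real set"
  shows "median_porous E \<longleftrightarrow> left_median_porous E \<and> right_median_porous E"
proof
  assume "median_porous E"
  then obtain p q where pq: "0 < p" "p < q" "q < 1" "spreads E 0 p q" "thick E q"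
    unfolding median_porous_def median_porous_with_iff_shift by (rule shift_porous_paramsE)
  have "\<exists>s t \<delta>. 0 < s \<and> s < t \<and> t < 1 \<and> 0 < \<delta> \<and> \<delta> < 1 \<and> shift_porous_with \<sigma> s t \<delta> E" for \<sigma>
    by (rule spreads_imp_shift_porous_params[OF spreads_all_shifts[OF pq(4,2)] pq(5,1,2,3)])
  then show "left_median_porous E \<and> right_median_porous E"
    unfolding left_median_porous_def right_median_porous_def
      left_median_porous_with_iff_shift right_median_porous_with_iff_shift by blast
next
  assume "left_median_porous E \<and> right_median_porous E"
  then have l: "left_median_porous E" and r: "right_median_porous E" by auto
  obtain p q where pq: "0 < p" "p < q" "q < 1" "spreads E (- 1) p q" "thick E q"
    using r unfolding right_median_porous_def right_median_porous_with_iff_shift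
    by (rule shift_porous_paramsE)
  obtain p' q' where pq': "0 < p'" "p' < q'" "q' < 1" "spreads E 1 p' q'" "thick E q'"
    using l unfolding left_median_porous_def left_median_porous_with_iff_shift
    by (rule shift_porous_paramsE)
  show "median_porous E"
    unfolding median_porous_def median_porous_with_iff_shift
  proof (cases "p' < q")
    case True
    define Q where "Q = (p' + q) / 2"
    have Q: "p' < Q" "Q < q" using True by (auto simp: Q_def)
    have "spreads E 0 p' Q"
      using pq pq' Q by (intro spreads_left_right_combine[OF pq(4) pq'(4)]) auto
    then show "\<exists>s t \<delta>. 0 < s \<and> s < t \<and> t < 1 \<and> 0 < \<delta> \<and> \<delta> < 1 \<and> shift_porous_with 0 s t \<delta> E"
      by (rule spreads_imp_shift_porous_params) (use Q pq pq' thick_mono[OF pq(5)] in auto)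
  next
    case False
    define Q where "Q = (p + q') / 2"
    have Q: "p < Q" "Q < q'" using False pq pq' by (auto simp: Q_def)
    have reflected: "spreads (uminus ` E) (- 1) p' q'" "spreads (uminus ` E) 1 p q"
      using spreads_uminus[OF pq'(4)] spreads_uminus[OF pq(4)] by simp_all
    have "spreads (uminus ` E) 0 p Q"
      using pq pq' Q by (intro spreads_left_right_combine[OF reflected]) auto
    then have "spreads E 0 p Q"
      using spreads_uminus[of "uminus ` E" 0 p Q] by (simp add: image_image)
    then show "\<exists>s t \<delta>. 0 < s \<and> s < t \<and> t < 1 \<and> 0 < \<delta> \<and> \<delta> < 1 \<and> shift_porous_with 0 s t \<delta> E"
      by (rule spreads_imp_shift_porous_params) (use Q pq pq' thick_mono[OF pq'(5)] in auto)
  qed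
qed

end
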